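(* Run the Tsallis-INF algorithm with power $\alpha=\frac12$, symmetric regularization ($\xi_i=1$ for all $i$), and learning rate $\eta_t = 2\sqrt{1/t}$ if (IW) loss estimators are used, respectively $\eta_t=4\sqrt{1/t}$ if (RV) loss estimators are used. Then, in any adversarial bandit problem with $K$ arms and for any time $T$, the pseudo-regret satisfies $$\overline{Reg}_T \le \begin{cases} 4\sqrt{KT}+1, & \text{with (IW) estimators},\\ 2\sqrt{KT}+10K\log(T)+16, & \text{with (RV) estimators}.\end{cases}$$ Furthermore, if there exist a vector $\Delta\in[0,1]^K$ with a unique zero entry $i^*$ (i.e., $\Delta_{i^*}=0$ and $\Delta_i>0$ for all $i\ne i^*$) and a constant $C$ such that the pseudo-regret at time $T$ satisfies $$\overline{Reg}_T\ \ge\ \mathbb{E}\left[\sum_{t=1}^T\sum_{i\neq i^*} w_{t,i}\Delta_i\right]-C,$$ then, with $\Delta_{\min}:=\min_{i:\Delta_i>0}\Delta_i$, the pseudo-regret further satisfies $$\overline{Reg}_T\le\begin{cases}\left(\sum_{i\ne i^*}\frac{4\log(T)+12}{\Delta_i}\right)+4\log(T)+\frac{2}{\Delta_{\min}}+\frac32\sqrt K+8+C, & \text{with (IW)},\\[4pt] \left(\sum_{i\ne i^*}\frac{\log(T)+3}{\Delta_i}\right)+28K\log(T)+\frac{2}{\Delta_{\min}}+\frac32\sqrt K+32+C, & \text{with (RV)}.\end{cases}$$ If moreover $C>\left(\sum_{i\ne i^*}\frac{4\log(T)+12}{\Delta_i}\right)+\frac{2}{\Delta_{\min}}$ in the (IW)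 case, respectively $C>\left(\sum_{i\ne i^*}\frac{\log(T)+3}{\Delta_i}\right)+\frac{2}{\Delta_{\min}}$ in the (RV) case, then additionally $$\overline{Reg}_T\le\begin{cases}2\sqrt{\left(\left(\sum_{i\ne i^*}\frac{4\log(T)+12}{\Delta_i}\right)+\frac{2}{\Delta_{\min}}\right)C}+4\log(T)+\frac32\sqrt K+8, & \text{with (IW)},\\[4pt] 2\sqrt{\left(\left(\sum_{i\ne i^*}\frac{\log(T)+3}{\Delta_i}\right)+\frac{2}{\Delta_{\min}}\right)C}+28K\log(T)+\frac32\sqrt K+32, & \text{with (RV)}.\end{cases}$$
   Context: Bandit setting. There are $K$ arms. In each round $t=1,2,\dots$ the environment picks a loss vector $\ell_t\in[0,1]^K$ and the agent chooses an arm $I_t\in\{1,\dots,K\}$; the agent observes and suffers only $\ell_{t,I_t}$. In the (adaptive) adversarial setting the losses $\ell_t$ are chosen arbitrarily, possibly depending on the agent's past actions $I_1,\dots,I_{t-1}$ and the adversary's own internal randomization (but not on $I_t$). The pseudo-regret is $$\overline{Reg}_T=\mathbb{E}\Big[\sum_{t=1}^T\ell_{t,I_t}\Big]-\min_i\mathbb{E}\Big[\sum_{t=1}^T\ell_{t,i}\Big],$$ with expectation over the randomization of both the algorithm and the environment. $\log$ is the natural logarithm; $T$ is a positive integer. Let $\Delta^{K-1}$ be the probability simplex in $\mathbb{R}^K$. Algorithm (Tsallis-INF with $\alpha=\frac12$, symmetric regularization). Let $\Psi_t(w)=-\frac{4}{\eta_t}\sum_{i=1}^K\left(\sqrt{w_i}-\frac12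 w_i\right)$. Set $\hat L_0=0\in\mathbb{R}^K$. In each round $t$: let $w_t=\arg\max_{w\in\Delta^{K-1}}\{\langle w,-\hat L_{t-1}\rangle-\Psi_t(w)\}$; sample $I_t\sim w_t$ (conditionally on the past); observe $\ell_{t,I_t}$; construct the estimator $\hat\ell_t\in\mathbb{R}^K$; set $\hat L_t=\hat L_{t-1}+\hat\ell_t$. Loss estimators (the same type is used in all rounds): (IW): $\hat\ell_{t,i}=\dfrac{\mathbf 1[I_t=i]\,\ell_{t,i}}{w_{t,i}}$. (RV): $\hat\ell_{t,i}=\dfrac{\mathbf 1[I_t=i]\,(\ell_{t,i}-\mathbb{B}_t(i))}{w_{t,i}}+\mathbb{B}_t(i)$, where $\mathbb{B}_t(i)=\frac12\mathbf 1[w_{t,i}\ge\eta_t^2]$. *)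

theory Defs
  imports "HOL-Probability.Probability"
begin

datatype estimator = IW | RV

definition prob_simplex :: "(real ^ 'k::finite) set" where
  "prob_simplex = {w. (\<forall>i. 0 \<le> w $ i) \<and> (\<Sum>i\<in>UNIV. w $ i) = 1}"

fun learning_rate :: "estimator \<Rightarrow> nat \<Rightarrow> real" where
  "learning_rate IW t = 2 * sqrt (1 / real t)"
| "learning_rate RV t = 4 * sqrt (1 / real t)"

definition tsallis_reg :: "real \<Rightarrow> real ^ 'k::finite \<Rightarrow> real" where
  "tsallis_reg \<eta> w = - (4 / \<eta>) * (\<Sum>i\<in>UNIV. sqrt (w $ i) - 1 / 2 * w $ i)"

text \<open>The objective is continuous and strictly concave on the compact simplex, so the maximiser
  chosen here exists and is unique; all its coordinates are positive, so the divisions by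
  \<open>w $ i\<close> below are genuine.\<close>

definition ftrl_weights :: "real \<Rightarrow> real ^ 'k::finite \<Rightarrow> real ^ 'k" where
  "ftrl_weights \<eta> L = arg_max_on (\<lambda>w. w \<bullet> (- L) - tsallis_reg \<eta> w) prob_simplex"

fun loss_estimate ::
  "estimator \<Rightarrow> real \<Rightarrow> real ^ 'k::finite \<Rightarrow> real ^ 'k \<Rightarrow> 'k \<Rightarrow> real ^ 'k" where
  "loss_estimate IW \<eta> w l a = (\<chi> i. of_bool (a = i) * l $ i / w $ i)"
| "loss_estimate RV \<eta> w l a =
    (\<chi> i. let B = 1 / 2 * of_bool (w $ i \<ge> \<eta>\<^sup>2)
         in of_bool (a = i) * (l $ i - B) / w $ i + B)"

text \<open>Along one trajectory of losses \<open>l\<close> and arms \<open>a\<close>, both indexed by rounds \<open>1, 2, \<dots>\<close>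
  (the values at index \<open>0\<close> are never used).\<close>

fun cum_estimate ::
  "estimator \<Rightarrow> (nat \<Rightarrow> real ^ 'k::finite) \<Rightarrow> (nat \<Rightarrow> 'k) \<Rightarrow> nat \<Rightarrow> real ^ 'k" where
  "cum_estimate e l a 0 = 0"
| "cum_estimate e l a (Suc t) =
    cum_estimate e l a t
      + loss_estimate e (learning_rate e (Suc t))
          (ftrl_weights (learning_rate e (Suc t)) (cum_estimate e l a t))
          (l (Suc t)) (a (Suc t))"

definition tsallis_weights ::
  "estimator \<Rightarrow> (nat \<Rightarrow> real ^ 'k::finite) \<Rightarrow> (nat \<Rightarrow> 'k) \<Rightarrow> nat \<Rightarrow> real ^ 'k" where
  "tsallis_weights e l a t = ftrl_weights (learning_rate e t) (cum_estimate e l a (t - 1))"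

text \<open>The sigma-algebra \<open>H t\<close> is everything determined before the learner draws in round \<open>t\<close>: the
  arms of the earlier rounds and the adversary's internal randomisation used up to and
  including round \<open>t\<close>. The loss vector of round \<open>t\<close> is an arbitrary \<open>H t\<close>-measurable function,
  which is what allows an adaptive adversary; that it does not depend on the arm of round \<open>t\<close>
  is expressed by the conditional law of that arm given \<open>H t\<close> being the learner's weights.
  If \<open>U\<close> is all of the adversary's randomness, drawn in advance, then
  \<open>H t\<close> is the sigma-algebra generated by \<open>U\<close> and the arms of rounds \<open>1, \<dots>, t - 1\<close>.\<close>

locale adversarial_tsallis_inf =
  prob_space M + filtration "space M" H
  for M :: "'a measure" and H :: "nat \<Rightarrow> 'a measure" +
  fixes loss :: "nat \<Rightarrow> 'a \<Rightarrow> real ^ 'k::finite"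
    and arm :: "nat \<Rightarrow> 'a \<Rightarrow> 'k"
    and e :: estimator
  assumes subalg: "\<And>t. subalgebra M (H t)"
    and loss_measurable: "\<And>t. 1 \<le> t \<Longrightarrow> loss t \<in> borel_measurable (H t)"
    and loss_range: "\<And>t \<omega> i. 1 \<le> t \<Longrightarrow> \<omega> \<in> space M \<Longrightarrow> loss t \<omega> $ i \<in> {0..1}"
    and arm_measurable: "\<And>s t. 1 \<le> s \<Longrightarrow> s < t \<Longrightarrow> arm s \<in> measurable (H t) (count_space UNIV)"
    and arm_sampled: "\<And>t i. 1 \<le> t \<Longrightarrow>
      AE \<omega> in M. real_cond_exp M (H t) (indicator {\<omega> \<in> space M. arm t \<omega> = i}) \<omega>
        = tsallis_weights e (\<lambda>s. loss s \<omega>) (\<lambda>s. arm s \<omega>) t $ i"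

definition pseudo_regret ::
  "'a measure \<Rightarrow> (nat \<Rightarrow> 'a \<Rightarrow> real ^ 'k::finite) \<Rightarrow> (nat \<Rightarrow> 'a \<Rightarrow> 'k) \<Rightarrow> nat \<Rightarrow> real" where
  "pseudo_regret M loss arm T =
    (\<integral>\<omega>. (\<Sum>t=1..T. loss t \<omega> $ arm t \<omega>) \<partial>M)
      - (MIN i. \<integral>\<omega>. (\<Sum>t=1..T. loss t \<omega> $ i) \<partial>M)"

text \<open>With a single arm there is no positive gap. The value \<open>0\<close> then makes \<open>2 / min_gap \<Delta>\<close>
  vanish because \<open>x / 0 = 0\<close>, matching the convention that an empty minimum is infinite.\<close>

definition min_gap :: "real ^ 'k::finite \<Rightarrow> real" where
  "min_gap \<Delta> = (if \<exists>i. \<Delta> $ i > 0 then Min {\<Delta> $ i | i. \<Delta> $ i > 0} else 0)"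

end

theory Submission
  imports Defs
begin

text \<open>For \<open>\<alpha> = 1/2\<close> everything is explicit: the optimality condition reads
  \<open>\<surd>w\<^sub>i = 2 / (\<eta> (L\<^sub>i - x))\<close>, so the Bregman divergence of the regulariser is a weighted sum of
  squares of \<open>\<surd>u\<^sub>i - \<surd>w\<^sub>i\<close>. The regret splits into a stability part, bounded in
  expectation by \<open>\<eta>/2 \<Sum> \<surd>w\<^sub>i (1 - w\<^sub>i)\<close> (a quarter of it for RV) up to a term of order \<open>\<eta>\<^sup>2\<close>,
  and a penalty part proportional to \<open>\<Sum> \<surd>w\<^sub>i - 1\<close>.
  The crude bound \<open>\<Sum> \<surd>w\<^sub>i \<le> \<surd>K\<close> gives the first claim. For the others, both parts are bounded by
  sums over the arms other than \<open>i\<^sup>*\<close>; if \<open>U\<close> is the resulting bound, then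
  \<open>2 U - \<mu> E[\<Sum> w\<^sub>i \<Delta>\<^sub>i]\<close> can be maximised over each weight separately, which yields the logarithmic
  terms divided by \<open>\<mu>\<close>. Taking \<open>\<mu> = 1\<close> or \<open>\<mu> = \<surd>(A / C)\<close> finishes the proof.\<close>

subsection \<open>The optimisation step\<close>

text \<open>The weights come from a choice operator and the estimates divide by them, so existence,
  measurability and integrability all have to be earned. The multiplier \<open>x\<close>, found by
  continuity, gives an explicit point; the divergence identity makes it the strict optimum and also
  yields Lipschitz dependence on the losses, hence measurability; the optimality formula bounds
  \<open>1 / w\<close> through the cumulative estimate, hence integrability. The factor
  \<open>1 - w\<close> in the stability bound comes from a shift that depends on the arm played. A
  bound by the sum of all \<open>sqrt w\<close> would stay of order one even when the weights
  concentrate, which rules out a logarithmic regret. For the same reason the regulariser of the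
  comparator is spread over the rounds: the penalty then vanishes at a vertex of the simplex. The
  combination \<open>2 U - \<mu> X\<close> arises from writing the regret as
  \<open>1 + \<mu>\<close> times itself minus \<open>\<mu>\<close> times itself, with
  \<open>\<mu> \<le> 1\<close>. Early rounds are treated apart, because for large learning rates the
  denominators of the stability bound can degenerate.\<close>

definition ftrl_objective :: "real \<Rightarrow> real ^ 'k::finite \<Rightarrow> real ^ 'k \<Rightarrow> real" where
  "ftrl_objective \<eta> L w = w \<bullet> L + tsallis_reg \<eta> w"

lemma prob_simplexD:
  assumes "w \<in> prob_simplex"
  shows "0 \<le> w $ i" "w $ i \<le> 1" "(\<Sum>i\<in>UNIV. w $ i) = 1"
proof -
  show 1: "0 \<le> w $ i" for i using assms by (auto simp: prob_simplex_def)
  show 2: "(\<Sum>i\<in>UNIV. w $ i) = 1" using assms by (auto simp: prob_simplex_def)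
  have "w $ i \<le> (\<Sum>i\<in>UNIV. w $ i)" by (rule member_le_sum) (auto simp: 1)
  then show "w $ i \<le> 1" using 2 by simp
qed

lemma tsallis_reg_simplex:
  assumes "w \<in> prob_simplex"
  shows "tsallis_reg \<eta> w = (2 - 4 * (\<Sum>i\<in>UNIV. sqrt (w $ i))) / \<eta>"
proof -
  have "(\<Sum>i\<in>UNIV. sqrt (w $ i) - 1 / 2 * w $ i) = (\<Sum>i\<in>UNIV. sqrt (w $ i)) - 1 / 2"
    unfolding sum_subtractf sum_distrib_left[symmetric] prob_simplexD(3)[OF assms] by simp
  then show ?thesis by (simp add: tsallis_reg_def right_diff_distrib diff_divide_distrib)
qed

text \<open>The right-hand side is the Bregman divergence of the regulariser; the KKT condition kills the
  first-order part of the objective.\<close>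

lemma ftrl_objective_diff:
  fixes L w u :: "real ^ 'k::finite"
  assumes "\<eta> > 0" "w \<in> prob_simplex" "u \<in> prob_simplex"
    and x: "\<And>i. x < L $ i" and kkt: "\<And>i. sqrt (w $ i) = 2 / (\<eta> * (L $ i - x))"
  shows "ftrl_objective \<eta> L u - ftrl_objective \<eta> L w
    = 2 / \<eta> * (\<Sum>i\<in>UNIV. (sqrt (u $ i) - sqrt (w $ i))\<^sup>2 / sqrt (w $ i))"
proof -
  have *: "(u $ i - w $ i) * (L $ i - x) - 4 / \<eta> * (sqrt (u $ i) - sqrt (w $ i))
      = 2 / \<eta> * ((sqrt (u $ i) - sqrt (w $ i))\<^sup>2 / sqrt (w $ i))" for i
  proof -
    define r where "r = sqrt (u $ i)"
    define s where "s = sqrt (w $ i)"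
    have s: "s > 0" using kkt[of i] x[of i] \<open>\<eta> > 0\<close> by (simp add: s_def)
    have L: "L $ i - x = 2 / (\<eta> * s)"
      using kkt[of i] x[of i] \<open>\<eta> > 0\<close> s unfolding s_def[symmetric] by (simp add: field_simps)
    have u: "u $ i = r\<^sup>2" "w $ i = s\<^sup>2"
      using prob_simplexD(1)[OF assms(2)] prob_simplexD(1)[OF assms(3)] by (auto simp: r_def s_def)
    show ?thesis unfolding L r_def[symmetric] s_def[symmetric] u
      using s \<open>\<eta> > 0\<close> by (simp add: field_simps power2_eq_square)
  qed
  have "(\<Sum>i\<in>UNIV. (u $ i - w $ i) * x) = 0"
    unfolding sum_distrib_right[symmetric] sum_subtractf
    using prob_simplexD(3)[OF assms(2)] prob_simplexD(3)[OF assms(3)] by simp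
  then have "ftrl_objective \<eta> L u - ftrl_objective \<eta> L w =
      (\<Sum>i\<in>UNIV. (u $ i - w $ i) * (L $ i - x) - 4 / \<eta> * (sqrt (u $ i) - sqrt (w $ i)))"
    using \<open>\<eta> > 0\<close>
    by (simp add: ftrl_objective_def tsallis_reg_simplex[OF assms(2)] tsallis_reg_simplex[OF assms(3)]
        inner_vec_def right_diff_distrib left_diff_distrib sum_subtractf sum_distrib_left[symmetric]
        diff_divide_distrib sum_divide_distrib[symmetric])
  also have "\<dots> = 2 / \<eta> * (\<Sum>i\<in>UNIV. (sqrt (u $ i) - sqrt (w $ i))\<^sup>2 / sqrt (w $ i))"
    by (simp only: * sum_distrib_left)
  finally show ?thesis .
qed

text \<open>\<open>x\<close> is the multiplier of the constraint that the weights sum to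
  \<open>1\<close>. The sum of the candidate weights is continuous left of its pole at the least
  loss \<open>m\<close>. At \<open>a\<close> every term is at most one over the number of arms, at
  \<open>b\<close> the term of a minimising arm alone is \<open>1\<close>, and \<open>b < m\<close>
  keeps the interval off the pole.\<close>

lemma kkt_point_exists:
  fixes L :: "real ^ 'k::finite"
  assumes "\<eta> > 0"
  obtains x where "\<And>i. x < L $ i" "(\<Sum>i\<in>UNIV. 4 / (\<eta> * (L $ i - x))\<^sup>2) = 1"
proof -
  define m where "m = Min (range (\<lambda>i. L $ i))"
  have m: "m \<le> L $ i" for i by (auto simp: m_def)
  obtain i0 where i0: "L $ i0 = m"
    using Min_in[of "range (\<lambda>i. L $ i)"] unfolding m_def by (auto simp: image_iff)
  define a where "a = m - 2 * sqrt CARD('k) / \<eta>"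
  define b where "b = m - 2 / \<eta>"
  define f where "f x = (\<Sum>i\<in>UNIV. 4 / (\<eta> * (L $ i - x))\<^sup>2)" for x
  have K: "real CARD('k) \<ge> 1" by (simp add: Suc_leI)
  have "sqrt CARD('k) \<ge> 1" using K by simp
  then have ab: "a \<le> b" using assms by (auto simp: a_def b_def divide_right_mono)
  have bm: "b < m" using assms by (simp add: b_def)
  have lt: "x < L $ i" if "x \<le> b" for x i using that bm m[of i] by linarith
  have fa: "f a \<le> 1"
  proof -
    have "f a \<le> (\<Sum>i::'k\<in>UNIV. 1 / real CARD('k))" unfolding f_def
    proof (rule sum_mono)
      fix i :: 'k
      have "\<eta> * (L $ i - a) \<ge> \<eta> * (m - a)" using m[of i] assms by simp
      moreover have "\<eta> * (m - a) = 2 * sqrt CARD('k)" using assms by (simp add: a_def)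
      ultimately have "(\<eta> * (L $ i - a))\<^sup>2 \<ge> (2 * sqrt CARD('k))\<^sup>2"
        by (intro power_mono) auto
      then have "(\<eta> * (L $ i - a))\<^sup>2 \<ge> 4 * real CARD('k)" by (simp add: power_mult_distrib)
      then have "4 / (\<eta> * (L $ i - a))\<^sup>2 \<le> 4 / (4 * real CARD('k))"
        by (intro divide_left_mono mult_pos_pos) (use K in \<open>auto simp del: power_mult_distrib\<close>)
      then show "4 / (\<eta> * (L $ i - a))\<^sup>2 \<le> 1 / real CARD('k)" by simp
    qed
    then show ?thesis by simp
  qed
  have fb: "f b \<ge> 1"
  proof -
    have "1 = 4 / (\<eta> * (L $ i0 - b))\<^sup>2" using assms i0 by (simp add: b_def)
    also have "\<dots> \<le> f b" unfolding f_def by (rule member_le_sum) auto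
    finally show ?thesis .
  qed
  have "\<forall>x\<in>{a..b}. (\<eta> * (L $ i - x))\<^sup>2 \<noteq> 0" for i
    using lt[of "L $ i" i] assms by auto
  then have "continuous_on {a..b} f" unfolding f_def
    by (intro continuous_on_sum continuous_on_divide) (auto intro!: continuous_intros)
  then obtain x where x: "a \<le> x" "x \<le> b" "f x = 1"
    using IVT'[of f a 1 b] fa fb ab by blast
  show thesis by (rule that[OF lt]) (use x in \<open>simp_all add: f_def\<close>)
qed

text \<open>Turns the choice in \<open>arg_max_on\<close> into a formula. By the divergence identity
  every other point of the simplex has a strictly larger objective than the point built from the
  multiplier, so the choice can return nothing else.\<close>

lemma ftrl_weights_kkt:
  fixes L :: "real ^ 'k::finite"
  assumes "\<eta> > 0"
  obtains x where "\<And>i. x < L $ i" "\<And>i. sqrt (ftrl_weights \<eta> L $ i) = 2 / (\<eta> * (L $ i - x))"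
    "ftrl_weights \<eta> L \<in> prob_simplex"
proof -
  obtain x where x: "\<And>i. x < L $ i" "(\<Sum>i\<in>UNIV. 4 / (\<eta> * (L $ i - x))\<^sup>2) = 1"
    using kkt_point_exists[OF assms] by blast
  define w :: "real ^ 'k" where "w = (\<chi> i. 4 / (\<eta> * (L $ i - x))\<^sup>2)"
  have w: "w \<in> prob_simplex" using x(2) by (auto simp: prob_simplex_def w_def)
  have s: "sqrt (w $ i) = 2 / (\<eta> * (L $ i - x))" for i
    using x(1)[of i] assms by (simp add: w_def real_sqrt_divide)
  have spos: "sqrt (w $ i) > 0" for i unfolding s using x(1)[of i] assms by simp
  have max: "ftrl_objective \<eta> L w < ftrl_objective \<eta> L u" if u: "u \<in> prob_simplex" "u \<noteq> w" for u
  proof -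
    obtain j where "u $ j \<noteq> w $ j" using u(2) by (auto simp: vec_eq_iff)
    then have j: "sqrt (u $ j) \<noteq> sqrt (w $ j)"
      by (simp add: real_sqrt_eq_iff)
    have "(\<Sum>i\<in>UNIV. (sqrt (u $ i) - sqrt (w $ i))\<^sup>2 / sqrt (w $ i)) > 0"
      by (rule sum_pos2[of _ j]) (use spos j in \<open>auto intro!: divide_pos_pos divide_nonneg_pos\<close>)
    then show ?thesis
      using ftrl_objective_diff[OF assms w u(1) x(1) s] assms by (smt (verit) divide_pos_pos mult_pos_pos)
  qed
  have obj: "(\<lambda>v. v \<bullet> (- L) - tsallis_reg \<eta> v) = (\<lambda>v. - ftrl_objective \<eta> L v)"
    by (simp add: ftrl_objective_def fun_eq_iff)
  have "ftrl_weights \<eta> L = w"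
    unfolding ftrl_weights_def obj arg_max_on_def arg_max_def
    by (rule some_equality) (use w max in \<open>fastforce simp: is_arg_max_def\<close>)+
  then show thesis using that[of x] x(1) s w by auto
qed

lemma ftrl_weights_in_simplex: "\<eta> > 0 \<Longrightarrow> ftrl_weights \<eta> L \<in> prob_simplex"
  using ftrl_weights_kkt[of \<eta> L] by metis

lemma ftrl_weights_pos:
  assumes "\<eta> > 0" shows "ftrl_weights \<eta> L $ i > 0"
proof -
  obtain x where "x < L $ i" "sqrt (ftrl_weights \<eta> L $ i) = 2 / (\<eta> * (L $ i - x))"
    using ftrl_weights_kkt[OF assms, of L] by metis
  with assms have "sqrt (ftrl_weights \<eta> L $ i) > 0" by simp
  then show ?thesis by simp
qed

lemma ftrl_objective_diff_weights:
  fixes L u :: "real ^ 'k::finite"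
  assumes "\<eta> > 0" "u \<in> prob_simplex"
  shows "ftrl_objective \<eta> L u - ftrl_objective \<eta> L (ftrl_weights \<eta> L)
    = 2 / \<eta> * (\<Sum>i\<in>UNIV. (sqrt (u $ i) - sqrt (ftrl_weights \<eta> L $ i))\<^sup>2 / sqrt (ftrl_weights \<eta> L $ i))"
proof -
  obtain x where x: "\<And>i. x < L $ i" "\<And>i. sqrt (ftrl_weights \<eta> L $ i) = 2 / (\<eta> * (L $ i - x))"
    "ftrl_weights \<eta> L \<in> prob_simplex"
    using ftrl_weights_kkt[OF assms(1)] by blast
  show ?thesis by (rule ftrl_objective_diff[OF assms(1) x(3) assms(2) x(1,2)])
qed

lemma ftrl_objective_min:
  fixes L u :: "real ^ 'k::finite"
  assumes "\<eta> > 0" "u \<in> prob_simplex"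
  shows "ftrl_objective \<eta> L (ftrl_weights \<eta> L) \<le> ftrl_objective \<eta> L u"
proof -
  have "0 \<le> 2 / \<eta> * (\<Sum>i\<in>UNIV. (sqrt (u $ i) - sqrt (ftrl_weights \<eta> L $ i))\<^sup>2 / sqrt (ftrl_weights \<eta> L $ i))"
    using assms ftrl_weights_pos[OF assms(1), of L]
    by (intro mult_nonneg_nonneg sum_nonneg divide_nonneg_nonneg) (auto intro: less_imp_le)
  then show ?thesis using ftrl_objective_diff_weights[OF assms, of L] by linarith
qed

text \<open>The inverse root of a weight is affine in its loss, some weight is at least the average,
  and two losses differ by at most \<open>2 * c\<close>. This bounds the estimates in terms of the
  past ones, which later gives integrability.\<close>

lemma ftrl_weights_inverse_sqrt_le:
  fixes L :: "real ^ 'k::finite"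
  assumes "\<eta> > 0" "\<And>i. \<bar>L $ i\<bar> \<le> c"
  shows "1 / sqrt (ftrl_weights \<eta> L $ i) \<le> \<eta> * c + sqrt CARD('k)"
proof -
  obtain x where x: "\<And>i. x < L $ i" "\<And>i. sqrt (ftrl_weights \<eta> L $ i) = 2 / (\<eta> * (L $ i - x))"
    and s: "ftrl_weights \<eta> L \<in> prob_simplex"
    using ftrl_weights_kkt[OF assms(1), of L] by metis
  have inv: "1 / sqrt (ftrl_weights \<eta> L $ i) = \<eta> * (L $ i - x) / 2" for i
    using x[of i] assms(1) by simp
  have "\<exists>j. ftrl_weights \<eta> L $ j \<ge> 1 / real CARD('k)"
  proof (rule ccontr)
    assume "\<not> ?thesis"
    then have "(\<Sum>j\<in>UNIV. ftrl_weights \<eta> L $ j) < (\<Sum>j::'k\<in>UNIV. 1 / real CARD('k))"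
      by (intro sum_strict_mono) (auto simp: not_le)
    then show False using prob_simplexD(3)[OF s] by simp
  qed
  then obtain j where "ftrl_weights \<eta> L $ j \<ge> 1 / real CARD('k)" by blast
  then have "sqrt (ftrl_weights \<eta> L $ j) \<ge> 1 / sqrt (real CARD('k))"
    by (metis real_sqrt_divide real_sqrt_le_iff real_sqrt_one)
  then have "1 / sqrt (ftrl_weights \<eta> L $ j) \<le> sqrt (real CARD('k))"
    using ftrl_weights_pos[OF assms(1), of L j] by (simp add: field_simps)
  then have "\<eta> * (L $ j - x) / 2 \<le> sqrt (real CARD('k))" unfolding inv .
  moreover have "\<eta> * (L $ i - L $ j) \<le> \<eta> * (2 * c)"
    using assms(1) assms(2)[of i] assms(2)[of j] by (intro mult_left_mono) linarith+
  ultimately show ?thesis unfolding inv by (simp add: algebra_simps)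
qed

text \<open>Strong convexity on the simplex. Both roots lie in \<open>[0, 1]\<close>:
  \<open>r + s \<le> 2\<close> costs the factor \<open>4\<close>, and dividing by
  \<open>s \<le> 1\<close> only enlarges the right-hand side.\<close>

lemma simplex_dist_le_divergence:
  fixes w u :: "real ^ 'k::finite"
  assumes "w \<in> prob_simplex" "u \<in> prob_simplex" "\<And>i. w $ i > 0"
  shows "(norm (u - w))\<^sup>2 / 4 \<le> (\<Sum>i\<in>UNIV. (sqrt (u $ i) - sqrt (w $ i))\<^sup>2 / sqrt (w $ i))"
proof -
  have "(u $ i - w $ i)\<^sup>2 / 4 \<le> (sqrt (u $ i) - sqrt (w $ i))\<^sup>2 / sqrt (w $ i)" for i
  proof -
    define r where "r = sqrt (u $ i)"
    define s where "s = sqrt (w $ i)"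
    have u: "u $ i = r\<^sup>2" "w $ i = s\<^sup>2"
      using prob_simplexD(1)[OF assms(1)] prob_simplexD(1)[OF assms(2)] by (auto simp: r_def s_def)
    have s: "0 < s" "s \<le> 1" "0 \<le> r" "r \<le> 1"
      using prob_simplexD(1,2)[OF assms(1), of i] prob_simplexD(1,2)[OF assms(2), of i] assms(3)[of i]
      by (auto simp: r_def s_def)
    have "(r\<^sup>2 - s\<^sup>2)\<^sup>2 = (r - s)\<^sup>2 * (r + s)\<^sup>2" by algebra
    also have "\<dots> \<le> (r - s)\<^sup>2 * 2\<^sup>2" using s by (intro mult_left_mono power_mono) auto
    finally have "(r\<^sup>2 - s\<^sup>2)\<^sup>2 / 4 \<le> (r - s)\<^sup>2" by simp
    also have "\<dots> \<le> (r - s)\<^sup>2 / s" using s by (simp add: le_divide_eq mult_left_le)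
    finally show ?thesis unfolding r_def[symmetric] s_def[symmetric] unfolding u .
  qed
  then have "(\<Sum>i\<in>UNIV. (u $ i - w $ i)\<^sup>2 / 4) \<le> (\<Sum>i\<in>UNIV. (sqrt (u $ i) - sqrt (w $ i))\<^sup>2 / sqrt (w $ i))"
    by (intro sum_mono) auto
  moreover have "(norm (u - w))\<^sup>2 = (\<Sum>i\<in>UNIV. (u $ i - w $ i)\<^sup>2)"
    unfolding power2_norm_eq_inner inner_vec_def by (simp add: power2_eq_square)
  ultimately show ?thesis by (simp add: sum_divide_distrib)
qed

text \<open>Each weight vector is tested against the other one in its own objective. In the sum of
  the two inequalities the regulariser cancels and \<open>(w' - w) \<bullet> (L - L')\<close>
  remains. The resulting continuity is what makes the weights measurable.\<close>

lemma ftrl_weights_lipschitz: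
  fixes L L' :: "real ^ 'k::finite"
  assumes "\<eta> > 0"
  shows "norm (ftrl_weights \<eta> L - ftrl_weights \<eta> L') \<le> \<eta> * norm (L - L')"
proof -
  let ?w = "ftrl_weights \<eta> L" and ?w' = "ftrl_weights \<eta> L'"
  note s = ftrl_weights_in_simplex[OF assms]
  have 1: "2 / \<eta> * ((norm (?w' - ?w))\<^sup>2 / 4) \<le> ftrl_objective \<eta> L ?w' - ftrl_objective \<eta> L ?w"
    unfolding ftrl_objective_diff_weights[OF assms s]
    using assms by (intro mult_left_mono simplex_dist_le_divergence s ftrl_weights_pos) auto
  have 2: "2 / \<eta> * ((norm (?w - ?w'))\<^sup>2 / 4) \<le> ftrl_objective \<eta> L' ?w - ftrl_objective \<eta> L' ?w'"
    unfolding ftrl_objective_diff_weights[OF assms s]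
    using assms by (intro mult_left_mono simplex_dist_le_divergence s ftrl_weights_pos) auto
  have "(norm (?w - ?w'))\<^sup>2 / \<eta> \<le> (?w' - ?w) \<bullet> (L - L')"
    using add_mono[OF 1 2]
    by (simp add: ftrl_objective_def norm_minus_commute inner_diff_left inner_diff_right)
  also have "\<dots> \<le> norm (?w - ?w') * norm (L - L')"
    using norm_cauchy_schwarz[of "?w' - ?w" "L - L'"] by (simp add: norm_minus_commute)
  finally have "norm (?w - ?w') * norm (?w - ?w') \<le> norm (?w - ?w') * (\<eta> * norm (L - L'))"
    using assms by (simp add: field_simps power2_eq_square)
  then show ?thesis
    using assms by (cases "norm (?w - ?w') = 0") (auto simp: mult_le_cancel_left)
qed

lemma continuous_ftrl_weights:
  assumes "\<eta> > 0"
  shows "continuous_on UNIV (ftrl_weights \<eta> :: real ^ 'k::finite \<Rightarrow> _)"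
proof -
  have "\<eta>-lipschitz_on UNIV (ftrl_weights \<eta> :: real ^ 'k \<Rightarrow> _)"
    using assms ftrl_weights_lipschitz[OF assms] by (intro lipschitz_onI) (auto simp: dist_norm)
  then show ?thesis by (rule lipschitz_on_continuous_on)
qed

subsection \<open>Stability of one step\<close>

text \<open>With \<open>\<Phi> L\<close> the minimal objective and \<open>w\<close> the weights at
  \<open>L\<close>, this is \<open>w \<bullet> z - (\<Phi> (L + z) - \<Phi> L)\<close>: the Bregman
  divergence, from \<open>- L\<close> to \<open>- (L + z)\<close>, of the convex conjugate of the
  regulariser on the simplex.\<close>

definition stability :: "real \<Rightarrow> real ^ 'k::finite \<Rightarrow> real ^ 'k \<Rightarrow> real" where
  "stability \<eta> L z = ftrl_weights \<eta> L \<bullet> z + ftrl_objective \<eta> L (ftrl_weights \<eta> L)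
     - ftrl_objective \<eta> (L + z) (ftrl_weights \<eta> (L + z))"

lemma stability_eq:
  "stability \<eta> L z = (ftrl_weights \<eta> L - ftrl_weights \<eta> (L + z)) \<bullet> z
     - (ftrl_objective \<eta> L (ftrl_weights \<eta> (L + z)) - ftrl_objective \<eta> L (ftrl_weights \<eta> L))"
  by (simp add: stability_def ftrl_objective_def inner_diff_left inner_add_right)

text \<open>The new point pays a nonnegative amount for nonnegative losses, and leaving the old
  optimum costs a nonnegative divergence. The learning rate may be arbitrarily large, so this serves
  the early rounds.\<close>

lemma stability_le_inner:
  assumes "\<eta> > 0" "\<And>i. z $ i \<ge> 0"
  shows "stability \<eta> L z \<le> ftrl_weights \<eta> L \<bullet> z"
proof -
  have "0 \<le> ftrl_weights \<eta> (L + z) \<bullet> z"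
    unfolding inner_vec_def using mult_nonneg_nonneg[OF less_imp_le[OF ftrl_weights_pos[OF assms(1)]] assms(2)]
    by (intro sum_nonneg) simp
  then show ?thesis
    using ftrl_objective_min[OF assms(1) ftrl_weights_in_simplex[OF assms(1)], of L "L + z"]
    by (simp add: stability_eq inner_diff_left)
qed

text \<open>The maximum over real \<open>r\<close> of \<open>(s\<^sup>2 - r\<^sup>2) * y - 2 /
  \<eta> * ((r - s)\<^sup>2 / s)\<close>, attained at
  \<open>r = s / (1 + \<eta> / 2 * s * y)\<close>. For positive \<open>\<eta>\<close> and
  \<open>s\<close> the quadratic is concave in \<open>r\<close> exactly when this denominator is
  positive.\<close>

definition stability_term :: "real \<Rightarrow> real \<Rightarrow> real \<Rightarrow> real" where
  "stability_term \<eta> s y = \<eta> / 2 * s ^ 3 * y\<^sup>2 / (1 + \<eta> / 2 * s * y)"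

lemma stability_term_ge:
  assumes "\<eta> > 0" "s > 0" "1 + \<eta> / 2 * s * y > 0"
  shows "(s\<^sup>2 - r\<^sup>2) * y - 2 / \<eta> * ((r - s)\<^sup>2 / s) \<le> stability_term \<eta> s y"
proof -
  define a where "a = \<eta> / 2 * s * y"
  have y: "y = 2 * a / (\<eta> * s)" using assms by (simp add: a_def)
  have a: "1 + a > 0" using assms(3) by (simp add: a_def)
  \<comment> \<open>Completing the square: the squared expression equals
    \<open>s - (1 + a) * r\<close> and vanishes at the maximiser.\<close>
  have "stability_term \<eta> s y - ((s\<^sup>2 - r\<^sup>2) * y - 2 / \<eta> * ((r - s)\<^sup>2 / s))
      = 2 / (\<eta> * s) * (((1 + a) * (s - r) - a * s)\<^sup>2 / (1 + a))"
    unfolding stability_term_def a_def[symmetric] unfolding y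
    using assms(1,2) a by (simp add: divide_simps) algebra
  also have "\<dots> \<ge> 0" using assms a by simp
  finally show ?thesis by simp
qed

text \<open>On the simplex a constant shift of all losses is invisible, so \<open>c\<close> may be chosen at will;
  each coordinate is then maximised separately.\<close>

lemma stability_le_shift:
  assumes "\<eta> > 0" "\<And>i. 1 + \<eta> / 2 * sqrt (ftrl_weights \<eta> L $ i) * (z $ i - c) > 0"
  shows "stability \<eta> L z \<le> (\<Sum>i\<in>UNIV. stability_term \<eta> (sqrt (ftrl_weights \<eta> L $ i)) (z $ i - c))"
proof -
  define w where "w = ftrl_weights \<eta> L"
  define u where "u = ftrl_weights \<eta> (L + z)"
  have w: "w \<in> prob_simplex" and u: "u \<in> prob_simplex"
    using ftrl_weights_in_simplex[OF assms(1)] by (auto simp: w_def u_def)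
  have c: "(\<Sum>i\<in>UNIV. (w $ i - u $ i) * c) = 0"
    unfolding sum_distrib_right[symmetric] sum_subtractf
    using prob_simplexD(3)[OF w] prob_simplexD(3)[OF u] by simp
  have "stability \<eta> L z = (\<Sum>i\<in>UNIV. (w $ i - u $ i) * z $ i)
      - 2 / \<eta> * (\<Sum>i\<in>UNIV. (sqrt (u $ i) - sqrt (w $ i))\<^sup>2 / sqrt (w $ i))"
    unfolding stability_eq u_def[symmetric] ftrl_objective_diff_weights[OF assms(1) u]
    by (simp add: inner_vec_def w_def)
  also have "\<dots> = (\<Sum>i\<in>UNIV. (w $ i - u $ i) * z $ i) - (\<Sum>i\<in>UNIV. (w $ i - u $ i) * c)
      - (\<Sum>i\<in>UNIV. 2 / \<eta> * ((sqrt (u $ i) - sqrt (w $ i))\<^sup>2 / sqrt (w $ i)))"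
    unfolding c sum_distrib_left by simp
  also have "\<dots> = (\<Sum>i\<in>UNIV. (w $ i - u $ i) * (z $ i - c)
      - 2 / \<eta> * ((sqrt (u $ i) - sqrt (w $ i))\<^sup>2 / sqrt (w $ i)))"
    by (simp only: sum_subtractf right_diff_distrib)
  also have "\<dots> \<le> (\<Sum>i\<in>UNIV. stability_term \<eta> (sqrt (w $ i)) (z $ i - c))"
  proof (rule sum_mono)
    fix i
    have "w $ i = (sqrt (w $ i))\<^sup>2" "u $ i = (sqrt (u $ i))\<^sup>2"
      using prob_simplexD(1)[OF w] prob_simplexD(1)[OF u] by auto
    then show "(w $ i - u $ i) * (z $ i - c)
        - 2 / \<eta> * ((sqrt (u $ i) - sqrt (w $ i))\<^sup>2 / sqrt (w $ i)) \<le> stability_term \<eta> (sqrt (w $ i)) (z $ i - c)"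
      using stability_term_ge[OF assms(1), of "sqrt (w $ i)" "z $ i - c" "sqrt (u $ i)"]
        assms(2)[of i] ftrl_weights_pos[OF assms(1), of L i] by (simp add: w_def)
  qed
  finally show ?thesis unfolding w_def .
qed

lemma stability_term_le:
  assumes "\<eta> > 0" "s > 0" "\<bar>y\<bar> \<le> m" "\<eta> / 2 * s * m \<le> b" "b < 1"
  shows "1 + \<eta> / 2 * s * y > 0" "stability_term \<eta> s y \<le> \<eta> / 2 * s ^ 3 * m\<^sup>2 / (1 - b)"
proof -
  have "\<eta> / 2 * s * (- m) \<le> \<eta> / 2 * s * y"
    using assms by (intro mult_left_mono) auto
  then have *: "1 + \<eta> / 2 * s * y \<ge> 1 - b" using assms(4) by simp
  then show "1 + \<eta> / 2 * s * y > 0" using assms(5) by simp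
  have "y\<^sup>2 \<le> m\<^sup>2" using assms(3) by (metis abs_ge_zero power2_abs power_mono)
  then show "stability_term \<eta> s y \<le> \<eta> / 2 * s ^ 3 * m\<^sup>2 / (1 - b)"
    unfolding stability_term_def using assms * by (intro frac_le mult_left_mono) auto
qed

lemma stability_term_le_nonneg:
  assumes "\<eta> > 0" "s > 0" "0 \<le> y" "y \<le> m"
  shows "1 + \<eta> / 2 * s * y > 0" "stability_term \<eta> s y \<le> \<eta> / 2 * s ^ 3 * m\<^sup>2"
proof -
  have *: "1 + \<eta> / 2 * s * y \<ge> 1" using assms by simp
  then show "1 + \<eta> / 2 * s * y > 0" by linarith
  have "y\<^sup>2 \<le> m\<^sup>2" using assms(3,4) by (intro power_mono) auto
  then have "stability_term \<eta> s y \<le> \<eta> / 2 * s ^ 3 * m\<^sup>2 / 1"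
    unfolding stability_term_def using assms * by (intro frac_le mult_left_mono) auto
  then show "stability_term \<eta> s y \<le> \<eta> / 2 * s ^ 3 * m\<^sup>2" by simp
qed

section \<open>Averaging one round over the arm played\<close>

lemma loss_estimate_unbiased:
  assumes "w \<in> prob_simplex" "\<And>i. w $ i > 0"
  shows "(\<Sum>a\<in>UNIV. w $ a * loss_estimate e \<eta> w l a $ i) = l $ i"
proof (cases e)
  case IW
  have "(\<Sum>a\<in>UNIV. w $ a * loss_estimate e \<eta> w l a $ i) = (\<Sum>a\<in>UNIV. if a = i then l $ i else 0)"
    using assms(2)[of i] by (intro sum.cong) (auto simp: IW)
  then show ?thesis by simp
next
  case RV
  define B where "B = 1 / 2 * of_bool (w $ i \<ge> \<eta>\<^sup>2) + (0::real)"
  have "(\<Sum>a\<in>UNIV. w $ a * loss_estimate e \<eta> w l a $ i)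
      = (\<Sum>a\<in>UNIV. (if a = i then l $ i - B else 0) + w $ a * B)"
    using assms(2)[of i] by (intro sum.cong) (auto simp: RV B_def Let_def field_simps)
  also have "\<dots> = l $ i"
    by (simp add: sum.distrib sum_distrib_right[symmetric] prob_simplexD(3)[OF assms(1)])
  finally show ?thesis .
qed

lemma expected_inner_estimate:
  assumes "w \<in> prob_simplex" "\<And>i. w $ i > 0"
  shows "(\<Sum>a\<in>UNIV. w $ a * (v \<bullet> loss_estimate e \<eta> w l a)) = v \<bullet> l"
proof -
  have "(\<Sum>a\<in>UNIV. w $ a * (v \<bullet> loss_estimate e \<eta> w l a))
      = (\<Sum>a\<in>UNIV. \<Sum>i\<in>UNIV. v $ i * (w $ a * loss_estimate e \<eta> w l a $ i))"
    by (simp add: inner_vec_def sum_distrib_left mult_ac)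
  also have "\<dots> = (\<Sum>i\<in>UNIV. \<Sum>a\<in>UNIV. v $ i * (w $ a * loss_estimate e \<eta> w l a $ i))"
    by (rule sum.swap)
  also have "\<dots> = v \<bullet> l"
    unfolding sum_distrib_left[symmetric] loss_estimate_unbiased[OF assms] by (simp add: inner_vec_def)
  finally show ?thesis .
qed

text \<open>The conditional expectation of the stability given the past, written as a finite sum
  over the arm drawn. The bounds of one round thereby become statements about real vectors.\<close>

definition expected_stability :: "estimator \<Rightarrow> real \<Rightarrow> real ^ 'k::finite \<Rightarrow> real ^ 'k \<Rightarrow> real" where
  "expected_stability e \<eta> L l = (\<Sum>a\<in>UNIV. ftrl_weights \<eta> L $ a
     * stability \<eta> L (loss_estimate e \<eta> (ftrl_weights \<eta> L) l a))"

text \<open>The estimates are nonnegative: for (IW) always, for (RV) because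
  \<open>\<eta> > 1\<close> puts every weight below \<open>\<eta>\<^sup>2\<close>, so that no
  baseline occurs. The stability is then at most the inner product with the estimate, which averages
  to \<open>w \<bullet> l \<le> 1\<close>.\<close>

lemma expected_stability_le_one:
  fixes L l :: "real ^ 'k::finite"
  assumes "\<eta> > 0" "\<And>i. l $ i \<in> {0..1}" "e = RV \<Longrightarrow> \<eta> > 1"
  shows "expected_stability e \<eta> L l \<le> 1"
proof -
  define w where "w = ftrl_weights \<eta> L"
  have w: "w \<in> prob_simplex" and pos: "\<And>i. w $ i > 0"
    using ftrl_weights_in_simplex[OF assms(1)] ftrl_weights_pos[OF assms(1)] by (auto simp: w_def)
  have low: "\<not> w $ i \<ge> \<eta>\<^sup>2" if "e = RV" for i
    using prob_simplexD(2)[OF w, of i] one_less_power[OF assms(3)[OF that], of 2] by simp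
  have "loss_estimate e \<eta> w l a $ i \<ge> 0" for a i
    using pos[of i] low assms(2)[of i] by (cases e) (auto simp: Let_def)
  then have "expected_stability e \<eta> L l \<le> (\<Sum>a\<in>UNIV. w $ a * (w \<bullet> loss_estimate e \<eta> w l a))"
    unfolding expected_stability_def w_def[symmetric]
    using pos stability_le_inner[OF assms(1), of _ L]
    by (intro sum_mono mult_left_mono) (auto simp: w_def less_imp_le)
  also have "\<dots> = w \<bullet> l" by (rule expected_inner_estimate[OF w pos])
  also have "\<dots> \<le> (\<Sum>i\<in>UNIV. w $ i)"
    unfolding inner_vec_def using assms(2) pos by (intro sum_mono) (auto simp: mult_left_le less_imp_le)
  finally show ?thesis using prob_simplexD(3)[OF w] by simp
qed

text \<open>Coordinate \<open>j\<close> contributes \<open>\<alpha> j\<close> when it is played and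
  \<open>\<beta> j\<close> otherwise; swapping the sums weighs these by \<open>w j\<close> and
  \<open>1 - w j\<close>.\<close>

lemma sum_sampled_split:
  fixes w f \<alpha> \<beta> :: "'k::finite \<Rightarrow> real"
  assumes "\<And>a. w a \<ge> 0" "(\<Sum>a\<in>UNIV. w a) = 1"
    "\<And>a. f a \<le> (\<Sum>j\<in>UNIV. if j = a then \<alpha> j else \<beta> j)"
  shows "(\<Sum>a\<in>UNIV. w a * f a) \<le> (\<Sum>j\<in>UNIV. w j * \<alpha> j + (1 - w j) * \<beta> j)"
proof -
  have "(\<Sum>a\<in>UNIV. w a * f a) \<le> (\<Sum>a\<in>UNIV. w a * (\<Sum>j\<in>UNIV. if j = a then \<alpha> j else \<beta> j))"
    using assms by (intro sum_mono mult_left_mono) auto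
  also have "\<dots> = (\<Sum>j\<in>UNIV. \<Sum>a\<in>UNIV. w a * (if j = a then \<alpha> j else \<beta> j))"
    by (subst sum.swap) (simp add: sum_distrib_left)
  also have "\<dots> = (\<Sum>j\<in>UNIV. w j * \<alpha> j + (1 - w j) * \<beta> j)"
  proof (rule sum.cong)
    fix j
    have "(\<Sum>a\<in>UNIV. w a * (if j = a then \<alpha> j else \<beta> j))
        = (\<Sum>a\<in>UNIV. (if a = j then w j * (\<alpha> j - \<beta> j) else 0) + w a * \<beta> j)"
      by (intro sum.cong) (auto simp: algebra_simps)
    also have "\<dots> = w j * (\<alpha> j - \<beta> j) + \<beta> j"
      by (simp add: sum.distrib sum_distrib_right[symmetric] assms(2))
    finally show "(\<Sum>a\<in>UNIV. w a * (if j = a then \<alpha> j else \<beta> j)) = w j * \<alpha> j + (1 - w j) * \<beta> j"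
      by (simp add: algebra_simps)
  qed simp
  finally show ?thesis .
qed

text \<open>Each arm \<open>a\<close> is a separate deterministic problem before averaging, so the
  shift \<open>c a\<close> may depend on the arm played. This freedom produces the factor
  \<open>1 - w\<close> below.\<close>

lemma expected_stability_le_split:
  fixes L l :: "real ^ 'k::finite"
  assumes "\<eta> > 0"
    and *: "\<And>a j. 1 + \<eta> / 2 * sqrt (ftrl_weights \<eta> L $ j) *
           (loss_estimate e \<eta> (ftrl_weights \<eta> L) l a $ j - c a) > 0 \<and>
         stability_term \<eta> (sqrt (ftrl_weights \<eta> L $ j))
           (loss_estimate e \<eta> (ftrl_weights \<eta> L) l a $ j - c a) \<le> (if j = a then \<alpha> j else \<beta> j)"
  shows "expected_stability e \<eta> L l
    \<le> (\<Sum>j\<in>UNIV. ftrl_weights \<eta> L $ j * \<alpha> j + (1 - ftrl_weights \<eta> L $ j) * \<beta> j)"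
  unfolding expected_stability_def
proof (rule sum_sampled_split)
  fix a :: 'k
  have "stability \<eta> L (loss_estimate e \<eta> (ftrl_weights \<eta> L) l a)
      \<le> (\<Sum>j\<in>UNIV. stability_term \<eta> (sqrt (ftrl_weights \<eta> L $ j))
           (loss_estimate e \<eta> (ftrl_weights \<eta> L) l a $ j - c a))"
    using * by (intro stability_le_shift assms(1)) blast
  also have "\<dots> \<le> (\<Sum>j\<in>UNIV. if j = a then \<alpha> j else \<beta> j)"
    using * by (intro sum_mono) blast
  finally show "stability \<eta> L (loss_estimate e \<eta> (ftrl_weights \<eta> L) l a)
      \<le> (\<Sum>j\<in>UNIV. if j = a then \<alpha> j else \<beta> j)" .
qed (use ftrl_weights_in_simplex[OF assms(1), of L] prob_simplexD in auto)

text \<open>With \<open>w = x\<^sup>2\<close>, the first summand is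
  \<open>w * x ^ 3 * ((1 - w) / w)\<^sup>2\<close>, the share of an arm when it is played, and the
  second is \<open>(1 - w) * x ^ 3\<close>, its share when it is not.\<close>

lemma sampled_split_identity: "x * (1 - x\<^sup>2)\<^sup>2 + x ^ 3 * (1 - x\<^sup>2) = x * (1 - (x :: real)\<^sup>2)"
  by (simp add: algebra_simps power2_eq_square power3_eq_cube)

text \<open>After the shift by \<open>l $ a\<close> the coordinate played is nonnegative, so its
  denominator only helps; the others equal \<open>- l $ a\<close> and have denominator at least
  \<open>1 - \<eta> / 2 * s\<close>, where \<open>\<eta>\<^sup>2 \<le> 2\<close> keeps
  \<open>\<eta> / 2 * s\<close> below \<open>3 / 4\<close>. Removing that denominator costs at most
  a multiple of \<open>w $ j\<close>, which sums up without a factor for the number of arms.\<close>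

lemma expected_stability_IW:
  fixes L l :: "real ^ 'k::finite"
  assumes "\<eta> > 0" "\<eta>\<^sup>2 \<le> 2" and l: "\<And>i. l $ i \<in> {0..1}"
  shows "expected_stability IW \<eta> L l
    \<le> \<eta> / 2 * (\<Sum>j\<in>UNIV. sqrt (ftrl_weights \<eta> L $ j) * (1 - ftrl_weights \<eta> L $ j)) + \<eta>\<^sup>2 / 4"
proof -
  define w where "w = ftrl_weights \<eta> L"
  define s where "s j = sqrt (w $ j)" for j
  define \<alpha> where "\<alpha> j = \<eta> / 2 * s j ^ 3 * ((1 - w $ j) / w $ j)\<^sup>2" for j
  define \<beta> where "\<beta> j = \<eta> / 2 * s j ^ 3 * 1\<^sup>2 / (1 - \<eta> / 2 * s j)" for j
  have w: "w \<in> prob_simplex" and pos: "\<And>i. w $ i > 0"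
    using ftrl_weights_in_simplex[OF assms(1)] ftrl_weights_pos[OF assms(1)] by (auto simp: w_def)
  have s: "s j > 0" "s j \<le> 1" "w $ j = (s j)\<^sup>2" for j
    using pos[of j] prob_simplexD(2)[OF w, of j] by (auto simp: s_def)
  have "\<eta> \<le> 3 / 2" using assms(1,2) by (intro power2_le_imp_le[of \<eta>]) (auto simp: power2_eq_square)
  then have b: "\<eta> / 2 * s j \<le> 3 / 4" for j
    using mult_mono[of "\<eta> / 2" "3 / 4" "s j" 1] s[of j] assms(1) by auto
  have "expected_stability IW \<eta> L l \<le> (\<Sum>j\<in>UNIV. w $ j * \<alpha> j + (1 - w $ j) * \<beta> j)"
    unfolding w_def
  proof (rule expected_stability_le_split[OF assms(1), where c = "\<lambda>a. l $ a"], unfold w_def[symmetric] s_def[symmetric])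
    fix a j
    show "1 + \<eta> / 2 * s j * (loss_estimate IW \<eta> w l a $ j - l $ a) > 0 \<and>
      stability_term \<eta> (s j) (loss_estimate IW \<eta> w l a $ j - l $ a) \<le> (if j = a then \<alpha> j else \<beta> j)"
    proof (cases "j = a")
      case True
      have e: "loss_estimate IW \<eta> w l a $ j - l $ a = l $ j * ((1 - w $ j) / w $ j)"
        using True pos[of j] by (simp add: field_simps)
      have d: "(1 - w $ j) / w $ j \<ge> 0" using pos[of j] prob_simplexD(2)[OF w, of j] by simp
      have y0: "0 \<le> l $ j * ((1 - w $ j) / w $ j)" using d l[of j] by (intro mult_nonneg_nonneg) auto
      have y1: "l $ j * ((1 - w $ j) / w $ j) \<le> (1 - w $ j) / w $ j"
        using d l[of j] by (intro mult_left_le_one_le) auto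
      show ?thesis unfolding e \<alpha>_def if_P[OF True]
        by (intro conjI stability_term_le_nonneg[OF assms(1) s(1)[of j] y0 y1])
    next
      case False
      then have e: "loss_estimate IW \<eta> w l a $ j - l $ a = - l $ a" by simp
      show ?thesis
        using stability_term_le[OF assms(1) s(1)[of j], of "- l $ a" 1 "\<eta> / 2 * s j"] False b[of j] l[of a]
        unfolding e \<beta>_def by auto
    qed
  qed
  also have "\<dots> \<le> (\<Sum>j\<in>UNIV. \<eta> / 2 * (s j * (1 - w $ j)) + \<eta>\<^sup>2 / 4 * w $ j)"
  proof (rule sum_mono)
    fix j
    define x where "x = s j"
    have x: "x > 0" "x \<le> 1" "w $ j = x\<^sup>2" "\<eta> / 2 * x \<le> 3 / 4" using s[of j] b[of j] by (auto simp: x_def)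
    have "w $ j * \<alpha> j = \<eta> / 2 * (x * (1 - x\<^sup>2)\<^sup>2)"
      unfolding \<alpha>_def x_def[symmetric] x(3) using x(1) by (simp add: field_simps power2_eq_square power3_eq_cube)
    moreover have "(1 - w $ j) * \<beta> j \<le> \<eta> / 2 * (x ^ 3 * (1 - x\<^sup>2)) + \<eta>\<^sup>2 / 4 * x\<^sup>2"
    proof -
      \<comment> \<open>\<open>(1 + 4 * y) * (1 - y)\<close> equals \<open>1\<close> at
        \<open>0\<close> and at \<open>3 / 4\<close>, so the slope \<open>4\<close> fits the range
        exactly.\<close>
      have "1 / (1 - \<eta> / 2 * x) \<le> 1 + 4 * (\<eta> / 2 * x)"
      proof -
        define y where "y = \<eta> / 2 * x"
        have "0 \<le> y" "y \<le> 3 / 4" using x assms(1) by (auto simp: y_def)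
        moreover have "(1 + 4 * y) * (1 - y) - 1 = y * (3 - 4 * y)" by algebra
        moreover have "y * (3 - 4 * y) \<ge> 0" using calculation by (intro mult_nonneg_nonneg) auto
        ultimately have "1 \<le> (1 + 4 * y) * (1 - y)" "1 - y > 0" by linarith+
        then show ?thesis unfolding y_def[symmetric] by (subst pos_divide_le_eq) auto
      qed
      moreover have "(1 - x\<^sup>2) * (\<eta> / 2 * x ^ 3) \<ge> 0"
        using x assms(1) by (intro mult_nonneg_nonneg) (auto simp: power_le_one)
      ultimately have "(1 - x\<^sup>2) * (\<eta> / 2 * x ^ 3) * (1 / (1 - \<eta> / 2 * x))
          \<le> (1 - x\<^sup>2) * (\<eta> / 2 * x ^ 3) * (1 + 4 * (\<eta> / 2 * x))" by (intro mult_left_mono) auto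
      also have "\<dots> = \<eta> / 2 * (x ^ 3 * (1 - x\<^sup>2)) + \<eta>\<^sup>2 * x\<^sup>2 * (x\<^sup>2 * (1 - x\<^sup>2))"
        by algebra
      also have "\<dots> \<le> \<eta> / 2 * (x ^ 3 * (1 - x\<^sup>2)) + \<eta>\<^sup>2 * x\<^sup>2 * (1 / 4)"
      proof -
        have "0 \<le> (x\<^sup>2 - 1 / 2)\<^sup>2" by simp
        then have "x\<^sup>2 * (1 - x\<^sup>2) \<le> 1 / 4" by (simp add: power2_eq_square algebra_simps)
        then show ?thesis by (intro add_left_mono mult_left_mono) auto
      qed
      finally show ?thesis unfolding \<beta>_def x_def[symmetric] x(3) by simp
    qed
    moreover have "\<eta> / 2 * (x * (1 - x\<^sup>2)\<^sup>2) + \<eta> / 2 * (x ^ 3 * (1 - x\<^sup>2)) = \<eta> / 2 * (x * (1 - x\<^sup>2))"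
        unfolding distrib_left[symmetric] sampled_split_identity ..
    ultimately show "w $ j * \<alpha> j + (1 - w $ j) * \<beta> j \<le> \<eta> / 2 * (s j * (1 - w $ j)) + \<eta>\<^sup>2 / 4 * w $ j"
      unfolding x_def[symmetric] x(3) by linarith
  qed
  also have "\<dots> = \<eta> / 2 * (\<Sum>j\<in>UNIV. s j * (1 - w $ j)) + \<eta>\<^sup>2 / 4"
    unfolding sum.distrib sum_distrib_left[symmetric] prob_simplexD(3)[OF w] by simp
  finally show ?thesis unfolding s_def w_def .
qed

lemma inverse_one_minus_le: "0 \<le> b \<Longrightarrow> b \<le> 1 / 4 \<Longrightarrow> 1 / (1 - b) \<le> 1 + 4 / 3 * (b :: real)"
proof -
  assume b: "0 \<le> b" "b \<le> 1 / 4"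
  have "(1 + 4 / 3 * b) * (1 - b) - 1 = 4 / 3 * (b * (1 / 4 - b))" by algebra
  moreover have "b * (1 / 4 - b) \<ge> 0" using b by simp
  ultimately have "1 \<le> (1 + 4 / 3 * b) * (1 - b)" by linarith
  then show ?thesis using b by (subst pos_divide_le_eq) auto
qed

text \<open>With a baseline the centred losses are at most \<open>1 / 2\<close> in absolute value;
  their squares turn \<open>\<eta> / 2\<close> into \<open>\<eta> / 8\<close>. Both signs occur now,
  but \<open>\<eta> \<le> s\<close> and \<open>\<eta> * s \<le> 1\<close> keep the denominators at
  least \<open>3 / 4\<close>. An arm without baseline has \<open>s < \<eta>\<close> and goes
  entirely into the slack: \<open>\<eta>\<^sup>2 / 2\<close> for being played,
  \<open>\<eta> ^ 4\<close> for not being played.\<close>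

lemma expected_stability_RV:
  fixes L l :: "real ^ 'k::finite"
  assumes "\<eta> > 0" "\<eta> \<le> 1" and l: "\<And>i. l $ i \<in> {0..1}"
  shows "expected_stability RV \<eta> L l
    \<le> \<eta> / 8 * (\<Sum>j\<in>UNIV. sqrt (ftrl_weights \<eta> L $ j) * (1 - ftrl_weights \<eta> L $ j))
      + real CARD('k) * (\<eta>\<^sup>2 / 2 + \<eta> ^ 4)"
proof -
  define w where "w = ftrl_weights \<eta> L"
  define s where "s j = sqrt (w $ j)" for j
  define \<alpha> where "\<alpha> j = (if w $ j \<ge> \<eta>\<^sup>2 then \<eta> / 2 * s j ^ 3 * ((1 - w $ j) / (2 * w $ j))\<^sup>2 / (1 - \<eta> / (4 * s j))
    else \<eta> / (2 * s j))" for j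
  define \<beta> where "\<beta> j = (if w $ j \<ge> \<eta>\<^sup>2 then \<eta> / 2 * s j ^ 3 * (1 / 2)\<^sup>2 / (1 - \<eta> / 4 * s j)
    else \<eta> / 2 * s j ^ 3 * 1\<^sup>2 / (1 - 1 / 2))" for j
  \<comment> \<open>Shifting by the played arm's loss produces the factor \<open>1 - w\<close>; if that arm has no baseline, the
    shift \<open>1 / 2\<close> makes all arms with baseline vanish.\<close>
  define c where "c a = (if w $ a \<ge> \<eta>\<^sup>2 then l $ a else 1 / 2)" for a
  have w: "w \<in> prob_simplex" and pos: "\<And>i. w $ i > 0"
    using ftrl_weights_in_simplex[OF assms(1)] ftrl_weights_pos[OF assms(1)] by (auto simp: w_def)
  have s: "s j > 0" "s j \<le> 1" "w $ j = (s j)\<^sup>2" for j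
    using pos[of j] prob_simplexD(2)[OF w, of j] by (auto simp: s_def)
  have b: "\<eta> * s j \<le> 1" for j
    using mult_mono[of \<eta> 1 "s j" 1] s[of j] assms(1,2) by auto
  have high: "w $ j \<ge> \<eta>\<^sup>2 \<longleftrightarrow> \<eta> \<le> s j" for j
    unfolding s(3) using s(1)[of j] assms(1) by (simp add: power2_le_iff_abs_le)
  have lt: "\<eta> / 4 * s j < 1" for j using b[of j] by simp
  have "expected_stability RV \<eta> L l \<le> (\<Sum>j\<in>UNIV. w $ j * \<alpha> j + (1 - w $ j) * \<beta> j)"
    unfolding w_def
  proof (rule expected_stability_le_split[OF assms(1), where c = c], unfold w_def[symmetric] s_def[symmetric])
    fix a j
    let ?y = "loss_estimate RV \<eta> w l a $ j - c a"
    note T = stability_term_le[OF assms(1) s(1)[of j]]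
    show "1 + \<eta> / 2 * s j * ?y > 0 \<and> stability_term \<eta> (s j) ?y \<le> (if j = a then \<alpha> j else \<beta> j)"
    proof (cases "j = a"; cases "w $ j \<ge> \<eta>\<^sup>2")
      assume j: "j = a" "w $ j \<ge> \<eta>\<^sup>2"
      define d where "d = (1 - w $ j) / (2 * w $ j)"
      have d: "d \<ge> 0" using pos[of j] prob_simplexD(2)[OF w, of j] by (simp add: d_def)
      have "?y = (2 * l $ j - 1) * d"
        using j pos[of j] by (simp add: c_def Let_def d_def field_simps)
      moreover have "\<bar>2 * l $ j - 1\<bar> \<le> 1" using l[of j] by auto
      ultimately have y: "\<bar>?y\<bar> \<le> d" using d by (simp add: abs_mult mult_left_le_one_le)
      have "s j * d \<le> s j * (1 / (2 * w $ j))"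
        using pos[of j] s[of j] by (intro mult_left_mono) (auto simp: d_def divide_right_mono)
      also have "\<dots> = 1 / (2 * s j)" unfolding s(3) using s(1)[of j] by (simp add: power2_eq_square)
      finally have "\<eta> / 2 * (s j * d) \<le> \<eta> / 2 * (1 / (2 * s j))" using assms(1) by (intro mult_left_mono) auto
      then have "\<eta> / 2 * s j * d \<le> \<eta> / (4 * s j)" by simp
      moreover have "\<eta> / (4 * s j) < 1" using j high[of j] s(1)[of j] by simp
      ultimately show ?thesis unfolding if_P[OF j(1)] \<alpha>_def if_P[OF j(2)] d_def[symmetric]
        by (intro conjI T[OF y])
    next
      assume j: "j = a" "\<not> w $ j \<ge> \<eta>\<^sup>2"
      have y: "?y = l $ j / w $ j - 1 / 2" using j by (simp add: c_def Let_def)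
      have alpha: "\<alpha> j = \<eta> / 2 * s j ^ 3 * (1 / w $ j)\<^sup>2"
        unfolding \<alpha>_def s(3) using j(2) s(1)[of j] unfolding s(3)
        by (simp add: field_simps power2_eq_square power3_eq_cube)
      show ?thesis
      proof (cases "?y \<ge> 0")
        case True
        have "l $ j / w $ j \<le> 1 / w $ j" using l[of j] pos[of j] by (intro divide_right_mono) auto
        then have "?y \<le> 1 / w $ j" unfolding y by linarith
        then show ?thesis unfolding if_P[OF j(1)] alpha
          by (intro conjI stability_term_le_nonneg[OF assms(1) s(1)[of j] True])
      next
        case False
        \<comment> \<open>Here the shift \<open>1 / 2\<close> exceeds the estimate; the difference
          is then at most \<open>1 / 2\<close> in size and its term is dominated by the same
          \<open>\<alpha> j\<close>.\<close>
        have "l $ j / w $ j \<ge> 0" using l[of j] pos[of j] by simp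
        then have "\<bar>?y\<bar> \<le> 1 / 2" using False unfolding y by linarith
        note T' = T[OF this, of "1 / 2"]
        have 1: "1 + \<eta> / 2 * s j * ?y > 0" by (rule T'(1)) (use b[of j] in auto)
        have "stability_term \<eta> (s j) ?y \<le> \<eta> / 2 * s j ^ 3 * (1 / 2)\<^sup>2 / (1 - 1 / 2)"
          by (rule T'(2)) (use b[of j] in auto)
        then have 2: "stability_term \<eta> (s j) ?y \<le> \<eta> / 4 * s j ^ 3" by (simp add: power2_eq_square)
        have "s j ^ 4 \<le> 1" using s[of j] by (intro power_le_one) auto
        then have "s j ^ 3 \<le> 1 / s j" using s(1)[of j] by (simp add: field_simps power_numeral_reduce)
        then have "\<eta> / 4 * s j ^ 3 \<le> \<eta> / 4 * (1 / s j)" using assms(1) by (intro mult_left_mono) auto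
        also have "\<dots> \<le> \<eta> / (2 * s j)" using assms(1) s(1)[of j] by (simp add: field_simps)
        finally show ?thesis using 1 2 unfolding if_P[OF j(1)] \<alpha>_def if_not_P[OF j(2)] by linarith
      qed
    next
      assume j: "j \<noteq> a" "w $ j \<ge> \<eta>\<^sup>2"
      then have y: "\<bar>?y\<bar> \<le> 1 / 2" using l[of a] by (auto simp: c_def Let_def abs_if)
      have "\<eta> / 2 * s j * (1 / 2) \<le> \<eta> / 4 * s j" by simp
      then show ?thesis unfolding if_not_P[OF j(1)] \<beta>_def if_P[OF j(2)]
        by (intro conjI T[OF y _ lt])
    next
      assume j: "j \<noteq> a" "\<not> w $ j \<ge> \<eta>\<^sup>2"
      then have y: "\<bar>?y\<bar> \<le> 1" using l[of a] by (auto simp: c_def Let_def)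
      have "\<eta> / 2 * s j * 1 \<le> 1 / 2" "1 / 2 < (1 :: real)" using b[of j] by auto
      then show ?thesis unfolding if_not_P[OF j(1)] \<beta>_def if_not_P[OF j(2)]
        by (intro conjI T[OF y])
    qed
  qed
  also have "\<dots> \<le> (\<Sum>j\<in>UNIV. \<eta> / 8 * (s j * (1 - w $ j)) + (\<eta>\<^sup>2 / 2 + \<eta> ^ 4))"
  proof (rule sum_mono)
    fix j
    define x where "x = s j"
    have x: "x > 0" "x \<le> 1" "w $ j = x\<^sup>2" "\<eta> * x \<le> 1" using s[of j] b[of j] by (auto simp: x_def)
    have x2: "0 \<le> 1 - x\<^sup>2" "1 - x\<^sup>2 \<le> 1" using x by (auto simp: power_le_one)
    show "w $ j * \<alpha> j + (1 - w $ j) * \<beta> j \<le> \<eta> / 8 * (s j * (1 - w $ j)) + (\<eta>\<^sup>2 / 2 + \<eta> ^ 4)"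
    proof (cases "w $ j \<ge> \<eta>\<^sup>2")
      case True
      then have ex: "\<eta> \<le> x" using high[of j] by (simp add: x_def)
      have 1: "1 / (1 - \<eta> / (4 * x)) \<le> 1 + 4 / 3 * (\<eta> / (4 * x))"
        using ex x assms(1) by (intro inverse_one_minus_le) (auto simp: field_simps)
      have 2: "1 / (1 - \<eta> / 4 * x) \<le> 1 + 4 / 3 * (\<eta> / 4 * x)"
        using x assms(1) by (intro inverse_one_minus_le) auto
      have "w $ j * \<alpha> j = \<eta> / 8 * (x * (1 - x\<^sup>2)\<^sup>2) * (1 / (1 - \<eta> / (4 * x)))"
        using True x(1) unfolding \<alpha>_def x_def[symmetric] x(3)
        by (simp add: power2_eq_square power3_eq_cube power_divide)
      also have "\<dots> \<le> \<eta> / 8 * (x * (1 - x\<^sup>2)\<^sup>2) * (1 + 4 / 3 * (\<eta> / (4 * x)))"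
        using x assms(1) by (intro mult_left_mono[OF 1]) auto
      also have "\<dots> = \<eta> / 8 * (x * (1 - x\<^sup>2)\<^sup>2) + \<eta>\<^sup>2 / 24 * (1 - x\<^sup>2)\<^sup>2"
        using x(1) by (simp add: field_simps power2_eq_square)
      also have "\<dots> \<le> \<eta> / 8 * (x * (1 - x\<^sup>2)\<^sup>2) + \<eta>\<^sup>2 / 24"
        using x2 by (simp add: power_le_one mult_left_le)
      finally have A: "w $ j * \<alpha> j \<le> \<eta> / 8 * (x * (1 - x\<^sup>2)\<^sup>2) + \<eta>\<^sup>2 / 24" .
      have "(1 - w $ j) * \<beta> j = \<eta> / 8 * (x ^ 3 * (1 - x\<^sup>2)) * (1 / (1 - \<eta> / 4 * x))"
        using True unfolding \<beta>_def x_def[symmetric] x(3) by (simp add: power2_eq_square)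
      also have "\<dots> \<le> \<eta> / 8 * (x ^ 3 * (1 - x\<^sup>2)) * (1 + 4 / 3 * (\<eta> / 4 * x))"
        using x x2 assms(1) by (intro mult_left_mono[OF 2]) auto
      also have "\<dots> = \<eta> / 8 * (x ^ 3 * (1 - x\<^sup>2)) + \<eta>\<^sup>2 / 24 * (x ^ 4 * (1 - x\<^sup>2))"
        by (simp add: field_simps power2_eq_square power_numeral_reduce)
      also have "\<dots> \<le> \<eta> / 8 * (x ^ 3 * (1 - x\<^sup>2)) + \<eta>\<^sup>2 / 24"
        using mult_mono[of "x ^ 4" 1 "1 - x\<^sup>2" 1] x2 x by (simp add: power_le_one mult_left_le)
      finally have B: "(1 - w $ j) * \<beta> j \<le> \<eta> / 8 * (x ^ 3 * (1 - x\<^sup>2)) + \<eta>\<^sup>2 / 24" .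
      have "\<eta> / 8 * (x * (1 - x\<^sup>2)\<^sup>2) + \<eta> / 8 * (x ^ 3 * (1 - x\<^sup>2)) = \<eta> / 8 * (x * (1 - x\<^sup>2))"
        unfolding distrib_left[symmetric] sampled_split_identity ..
      moreover have "\<eta> ^ 4 \<ge> 0" by simp
      moreover have "\<eta>\<^sup>2 \<ge> 0" by simp
      ultimately show ?thesis using A B unfolding x_def[symmetric] x(3) by linarith
    next
      case False
      then have ex: "x \<le> \<eta>" using high[of j] by (simp add: x_def)
      have "w $ j * \<alpha> j = \<eta> / 2 * x"
        using False x(1) unfolding \<alpha>_def x_def[symmetric] x(3) by (simp add: power2_eq_square)
      also have "\<dots> \<le> \<eta> / 2 * \<eta>" using ex assms(1) by (intro mult_left_mono) auto
      finally have A: "w $ j * \<alpha> j \<le> \<eta>\<^sup>2 / 2" by (simp add: power2_eq_square)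
      have "(1 - w $ j) * \<beta> j = (1 - x\<^sup>2) * (\<eta> * x ^ 3)"
        using False unfolding \<beta>_def x_def[symmetric] x(3) by simp
      also have "\<dots> \<le> 1 * (\<eta> * \<eta> ^ 3)"
        using ex x x2 assms(1) by (intro mult_mono power_mono) auto
      finally have B: "(1 - w $ j) * \<beta> j \<le> \<eta> ^ 4" by (simp add: power_numeral_reduce)
      have "\<eta> / 8 * (x * (1 - x\<^sup>2)) \<ge> 0" using x x2 assms(1) by simp
      then show ?thesis using A B unfolding x_def[symmetric] x(3) by linarith
    qed
  qed
  also have "\<dots> = \<eta> / 8 * (\<Sum>j\<in>UNIV. s j * (1 - w $ j)) + real CARD('k) * (\<eta>\<^sup>2 / 2 + \<eta> ^ 4)"
    unfolding sum.distrib sum_distrib_left[symmetric] by (simp add: distrib_left)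
  finally show ?thesis unfolding s_def w_def .
qed

subsection \<open>Stability and penalty along the rounds\<close>

lemma inverse_le_ln_diff:
  assumes "t \<ge> 1"
  shows "1 / (real t + 1) \<le> ln (real t + 1) - ln (real t)"
proof -
  have "ln (real t / (real t + 1)) \<le> real t / (real t + 1) - 1"
    using assms by (intro ln_le_minus_one) auto
  also have "\<dots> = - 1 / (real t + 1)" by (simp add: field_simps)
  finally show ?thesis using assms by (simp add: ln_div)
qed

lemma sum_inverse_le_ln:
  assumes "T \<ge> 1"
  shows "(\<Sum>t=1..T. 1 / real t) \<le> 1 + ln (real T)"
  using assms
proof (induction T rule: nat_induct_at_least)
  case (Suc t)
  then show ?case using inverse_le_ln_diff[of t] by (simp add: add.commute)
qed simp

lemma sqrt_diff_ge:
  assumes "t \<ge> 1"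
  shows "1 / (2 * sqrt (real t)) \<le> sqrt (real t) - sqrt (real (t - 1))"
proof -
  have t: "real t = real (t - 1) + 1" using assms by simp
  define \<tau> where "\<tau> = sqrt (real t)"
  define \<sigma> where "\<sigma> = sqrt (real (t - 1))"
  have "\<tau> > 0" using assms by (simp add: \<tau>_def)
  have "\<tau> ^ 2 = \<sigma> ^ 2 + 1" unfolding \<tau>_def \<sigma>_def using t by (simp only: real_sqrt_pow2 of_nat_0_le_iff)
  then have "2 * \<tau> * (\<tau> - \<sigma>) - 1 = (\<tau> - \<sigma>)\<^sup>2" by (simp add: power2_eq_square algebra_simps)
  then have "2 * \<tau> * (\<tau> - \<sigma>) - 1 \<ge> 0" by simp
  then show ?thesis unfolding \<tau>_def[symmetric] \<sigma>_def[symmetric] using \<open>\<tau> > 0\<close>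
    by (simp add: pos_divide_le_eq mult_ac)
qed

lemma sqrt_diff_le:
  assumes "t \<ge> 1"
  shows "sqrt (real t + 1) - sqrt (real t) \<le> 1 / (2 * sqrt (real t))"
proof -
  define \<tau> where "\<tau> = sqrt (real t)"
  define \<sigma> where "\<sigma> = sqrt (real t + 1)"
  have "\<tau> > 0" using assms by (simp add: \<tau>_def)
  have "\<sigma> ^ 2 = \<tau> ^ 2 + 1" unfolding \<tau>_def \<sigma>_def by simp
  then have "1 - 2 * \<tau> * (\<sigma> - \<tau>) = (\<sigma> - \<tau>)\<^sup>2" by (simp add: power2_eq_square algebra_simps)
  then have "1 - 2 * \<tau> * (\<sigma> - \<tau>) \<ge> 0" by simp
  then show ?thesis unfolding \<tau>_def[symmetric] \<sigma>_def[symmetric] using \<open>\<tau> > 0\<close>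
    by (simp add: pos_le_divide_eq mult_ac)
qed

lemma sum_inverse_sqrt_le:
  assumes "T \<ge> 1"
  shows "(\<Sum>t=1..T. if t = 1 then 0 else 1 / sqrt (real t)) \<le> 2 * sqrt (real T) - 2"
  using assms
proof (induction T rule: nat_induct_at_least)
  case (Suc t)
  then show ?case using sqrt_diff_ge[of "Suc t"] by auto
qed simp

text \<open>The penalty weight \<open>2 * (sqrt t - sqrt (t - 1))\<close> exceeds the stability
  weight \<open>1 / sqrt t\<close> by a summable amount. Bounding \<open>1 / sqrt t\<close> from
  below by \<open>2 * (sqrt (t + 1) - sqrt t)\<close> telescopes the total to at most
  \<open>2 * sqrt 2 - 2\<close>.\<close>

lemma sum_sqrt_defect_le:
  assumes "T \<ge> 1"
  shows "(\<Sum>t=1..T. if t = 1 then 0 else 2 * (sqrt (real t) - sqrt (real (t - 1))) - 1 / sqrt (real t))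
    \<le> 83 / 100"
proof -
  have "(\<Sum>t=1..T. if t = 1 then 0 else 2 * (sqrt (real t) - sqrt (real (t - 1))) - 1 / sqrt (real t))
      \<le> 2 * sqrt (real T) - 2 * sqrt (real T + 1) + 2 * sqrt 2 - 2"
    using assms
  proof (induction T rule: nat_induct_at_least)
    case (Suc t)
    then show ?case using sqrt_diff_le[of "Suc t"] by (auto simp: add.commute)
  qed simp
  moreover have "sqrt (real T) \<le> sqrt (real T + 1)" by simp
  moreover have "sqrt 2 \<le> (283 / 200 :: real)" by (rule real_le_lsqrt) (auto simp: power2_eq_square)
  ultimately show ?thesis by linarith
qed

text \<open>Lets both estimators share one argument. With \<open>\<gamma>\<close> for this factor,
  \<open>1 / \<eta>\<close> is \<open>\<gamma> * sqrt t / 2\<close>, and the leading stability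
  coefficient, \<open>\<eta> / 2\<close> for (IW) and \<open>\<eta> / 8\<close> for (RV), is
  \<open>\<gamma> / sqrt t\<close> in either case.\<close>

definition rate_factor :: "estimator \<Rightarrow> real" where
  "rate_factor e = (case e of IW \<Rightarrow> 1 | RV \<Rightarrow> 1 / 2)"

lemma rate_factor_pos: "rate_factor e > 0"
  by (simp add: rate_factor_def split: estimator.split)

lemma learning_rate_eq: "learning_rate e t = 2 / (rate_factor e * sqrt (real t))"
  by (cases e) (simp_all add: rate_factor_def real_sqrt_divide)

lemma learning_rate_pos: "t \<ge> 1 \<Longrightarrow> learning_rate e t > 0"
  using rate_factor_pos by (simp add: learning_rate_eq)

definition root_spread :: "real ^ 'k::finite \<Rightarrow> real" where
  "root_spread w = (\<Sum>j\<in>UNIV. sqrt (w $ j) * (1 - w $ j))"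

text \<open>A quarter of the amount by which the regulariser with \<open>\<eta> = 1\<close> at a
  vertex, where it is \<open>- 2\<close>, exceeds its value at \<open>w\<close>. On the simplex it
  is zero only at the vertices.\<close>

definition root_excess :: "real ^ 'k::finite \<Rightarrow> real" where
  "root_excess w = (\<Sum>j\<in>UNIV. sqrt (w $ j)) - 1"

text \<open>In rounds \<open>t < 16\<close> of (RV) all weights are below \<open>\<eta>\<^sup>2 = 16 / t\<close>, so there is no baseline, the estimates
  are nonnegative and the stability is at most \<open>1\<close>.\<close>

definition stability_slack :: "estimator \<Rightarrow> real \<Rightarrow> nat \<Rightarrow> real" where
  "stability_slack e K t = (case e of
      IW \<Rightarrow> 1 / real t
    | RV \<Rightarrow> if t < 16 then 1 else K * (8 / real t + 256 / (real t)\<^sup>2))"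

lemma root_spread_nonneg: "w \<in> prob_simplex \<Longrightarrow> root_spread w \<ge> 0"
  unfolding root_spread_def by (intro sum_nonneg mult_nonneg_nonneg) (auto simp: prob_simplexD)

lemma root_excess_nonneg:
  assumes "w \<in> prob_simplex"
  shows "root_excess w \<ge> 0"
proof -
  have "(\<Sum>j\<in>UNIV. w $ j) \<le> (\<Sum>j\<in>UNIV. sqrt (w $ j))"
  proof (rule sum_mono)
    fix j
    have "(w $ j)\<^sup>2 \<le> w $ j" using prob_simplexD(1,2)[OF assms, of j] by (simp add: power2_eq_square mult_left_le)
    then show "w $ j \<le> sqrt (w $ j)" by (rule real_le_rsqrt)
  qed
  then show ?thesis unfolding root_excess_def prob_simplexD(3)[OF assms] by simp
qed

lemma sum_sqrt_simplex_le:
  fixes w :: "real ^ 'k::finite"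
  assumes "w \<in> prob_simplex"
  shows "(\<Sum>j\<in>UNIV. sqrt (w $ j)) \<le> sqrt (real CARD('k))"
proof (rule real_le_rsqrt)
  have "(\<Sum>j\<in>UNIV. sqrt (w $ j))\<^sup>2 \<le> (\<Sum>j\<in>UNIV. (sqrt (w $ j))\<^sup>2) * real CARD('k)"
    by (rule sum_squared_le_sum_of_squares)
  also have "\<dots> = real CARD('k)" using prob_simplexD[OF assms] by simp
  finally show "(\<Sum>j\<in>UNIV. sqrt (w $ j))\<^sup>2 \<le> real CARD('k)" .
qed

lemma root_spread_le:
  fixes w :: "real ^ 'k::finite"
  assumes "w \<in> prob_simplex"
  shows "root_spread w \<le> sqrt (real CARD('k))"
proof -
  have "root_spread w \<le> (\<Sum>j\<in>UNIV. sqrt (w $ j))"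
    unfolding root_spread_def using prob_simplexD[OF assms] by (intro sum_mono) (simp add: mult_left_le)
  then show ?thesis using sum_sqrt_simplex_le[OF assms] by simp
qed

text \<open>In the first round of (IW) \<open>\<eta> / 2 = 1\<close>, so
  \<open>1 - \<eta> / 2 * s\<close> has no positive lower bound; the trivial bound \<open>1\<close>
  replaces the main term there. For (RV) the trivial bound covers all rounds with
  \<open>\<eta> > 1\<close>.\<close>

lemma expected_stability_bound:
  fixes L l :: "real ^ 'k::finite" and e :: estimator
  assumes t: "t \<ge> 1" and l: "\<And>i. l $ i \<in> {0..1}"
  defines "\<eta> \<equiv> learning_rate e t"
  shows "expected_stability e \<eta> L l
    \<le> rate_factor e * (if t = 1 then 0 else root_spread (ftrl_weights \<eta> L) / sqrt (real t))
      + stability_slack e (real CARD('k)) t"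
proof -
  have pos: "\<eta> > 0" using learning_rate_pos[OF t] by (simp add: \<eta>_def)
  note Q = root_spread_nonneg[OF ftrl_weights_in_simplex[OF pos], of L]
  show ?thesis
  proof (cases e)
    case IW
    show ?thesis
    proof (cases "t = 1")
      case True
      then show ?thesis using expected_stability_le_one[OF pos l, where e = e and L = L] IW
        by (simp add: stability_slack_def rate_factor_def)
    next
      case False
      have e2: "\<eta>\<^sup>2 = 4 / real t" by (simp add: \<eta>_def IW power_mult_distrib)
      have "\<eta>\<^sup>2 \<le> 2" unfolding e2 using False t by (simp add: field_simps)
      from expected_stability_IW[OF pos this l, where L = L] show ?thesis
        using False unfolding e2 by (simp add: IW \<eta>_def root_spread_def stability_slack_def rate_factor_def real_sqrt_divide)
    qed
  next
    case RV
    have e2: "\<eta>\<^sup>2 = 16 / real t" by (simp add: \<eta>_def RV power_mult_distrib)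
    show ?thesis
    proof (cases "t < 16")
      case True
      have "1\<^sup>2 < \<eta>\<^sup>2" unfolding e2 using True t by simp
      then have "\<eta> > 1" using pos by (intro power2_less_imp_less[of 1 \<eta>]) auto
      then have "expected_stability e \<eta> L l \<le> 1" using expected_stability_le_one[OF pos l] by blast
      moreover have "0 \<le> rate_factor e * (if t = 1 then 0 else root_spread (ftrl_weights \<eta> L) / sqrt (real t))"
        using Q less_imp_le[OF rate_factor_pos[of e]] by simp
      ultimately show ?thesis using True by (simp add: stability_slack_def RV)
    next
      case False
      have "\<eta>\<^sup>2 \<le> 1\<^sup>2" unfolding e2 using False by simp
      then have le: "\<eta> \<le> 1" using pos by (intro power2_le_imp_le[of \<eta> 1]) auto
      have e4: "\<eta> ^ 4 = 256 / (real t)\<^sup>2"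
      proof -
        have "\<eta> ^ 4 = (\<eta>\<^sup>2)\<^sup>2" by simp
        then show ?thesis unfolding e2 by (simp add: power_divide)
      qed
      have "\<eta> / 8 = 1 / (2 * sqrt (real t))" by (simp add: \<eta>_def RV real_sqrt_divide)
      then show ?thesis using expected_stability_RV[OF pos le l, where L = L] False unfolding e2 e4
        by (simp add: RV root_spread_def stability_slack_def rate_factor_def)
    qed
  qed
qed

text \<open>The induction starts at \<open>15\<close>, the last round with slack \<open>1\<close>;
  beyond it \<open>1 / (t + 1)\<^sup>2\<close> is at most the telescoping
  \<open>1 / t - 1 / (t + 1)\<close>.\<close>

lemma sum_slack_RV_tail:
  assumes "T \<ge> 15" "K \<ge> 0"
  shows "(\<Sum>t=1..T. stability_slack RV K t)
    \<le> 15 + K * (8 * (ln (real T) - ln 15) + 256 * (1 / 15 - 1 / real T))"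
  using assms(1)
proof (induction T rule: nat_induct_at_least)
  case base
  have "(\<Sum>t=1..15. stability_slack RV K t) = (\<Sum>t::nat=1..15. 1)"
    by (intro sum.cong) (auto simp: stability_slack_def)
  then show ?case by simp
next
  case (Suc t)
  have "1 / (real t + 1)\<^sup>2 \<le> 1 / (real t * (real t + 1))"
    using Suc by (intro divide_left_mono) (auto simp: power2_eq_square)
  also have "\<dots> = 1 / real t - 1 / (real t + 1)" using Suc by (simp add: field_simps)
  finally have "8 * (1 / (real t + 1)) + 256 * (1 / (real t + 1)\<^sup>2)
      \<le> 8 * (ln (real t + 1) - ln (real t)) + 256 * (1 / real t - 1 / (real t + 1))"
    using inverse_le_ln_diff[of t] Suc by (intro add_mono mult_left_mono) auto
  then have "K * (8 * (1 / (real t + 1)) + 256 * (1 / (real t + 1)\<^sup>2))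
      \<le> K * (8 * (ln (real t + 1) - ln (real t)) + 256 * (1 / real t - 1 / (real t + 1)))"
    using assms(2) by (rule mult_left_mono)
  moreover have "stability_slack RV K (Suc t) = K * (8 * (1 / (real t + 1)) + 256 * (1 / (real t + 1)\<^sup>2))"
    using Suc by (simp add: stability_slack_def add.commute)
  ultimately show ?case using Suc by (simp add: algebra_simps)
qed

definition total_slack :: "estimator \<Rightarrow> real \<Rightarrow> nat \<Rightarrow> real" where
  "total_slack e K T = (case e of IW \<Rightarrow> 1 + ln (real T) | RV \<Rightarrow> 15 + 10 * K * ln (real T))"

lemma sum_stability_slack_le:
  assumes "T \<ge> 1" "K \<ge> 0"
  shows "(\<Sum>t=1..T. stability_slack e K t) \<le> total_slack e K T"
proof (cases e)
  case IW
  then show ?thesis using sum_inverse_le_ln[OF assms(1)] by (simp add: stability_slack_def total_slack_def)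
next
  case RV
  show ?thesis
  proof (cases "T \<ge> 15")
    case True
    \<comment> \<open>\<open>ln 15 \<ge> 2\<close> makes \<open>8 * ln 15\<close> absorb all but
      about \<open>1\<close> of \<open>256 / 15\<close>; the remainder fits into the spare
      \<open>2 * ln T\<close>.\<close>
    have "3 * ln 2 = ln (8 :: real)" using ln_realpow[of 2 3] by simp
    moreover have "ln (8 :: real) \<le> ln 15" by simp
    ultimately have "ln (15 :: real) \<ge> 2" using ln2_ge_two_thirds by linarith
    moreover have "ln 15 \<le> ln (real T)" using True by simp
    ultimately have "8 * (ln (real T) - ln 15) + 256 / 15 \<le> 10 * ln (real T)" by argo
    moreover have "256 * (1 / 15 - 1 / real T) \<le> 256 / 15" by simp
    ultimately have "8 * (ln (real T) - ln 15) + 256 * (1 / 15 - 1 / real T) \<le> 10 * ln (real T)"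
      by argo
    then have "K * (8 * (ln (real T) - ln 15) + 256 * (1 / 15 - 1 / real T)) \<le> K * (10 * ln (real T))"
      using assms(2) by (rule mult_left_mono)
    then show ?thesis using sum_slack_RV_tail[OF True assms(2)] by (simp add: RV total_slack_def)
  next
    case False
    have "(\<Sum>t=1..T. stability_slack e K t) = (\<Sum>t=1..T. 1)"
      using False by (intro sum.cong) (auto simp: stability_slack_def RV)
    moreover have "0 \<le> 10 * K * ln (real T)" using assms by simp
    moreover have "real T \<le> 15" using False by simp
    ultimately show ?thesis unfolding RV total_slack_def by simp
  qed
qed

text \<open>The comparator \<open>u\<close> stays arbitrary in the induction: the step uses
  optimality of the new leader against \<open>u\<close>, then applies the hypothesis to the weights
  of the last round as comparator. The change of scale between the two regularisers is the penalty
  increment. \<open>\<eta> 0 = 0\<close> makes \<open>1 / \<eta> 0 = 0\<close>, so the first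
  increment is the full \<open>1 / \<eta> 1\<close>.\<close>

lemma ftrl_regret_pathwise:
  fixes z L :: "nat \<Rightarrow> real ^ 'k::finite" and \<eta> :: "nat \<Rightarrow> real"
  assumes L: "L 0 = 0" "\<And>t. L (Suc t) = L t + z (Suc t)"
    and \<eta>: "\<eta> 0 = 0" "\<And>t. t \<ge> 1 \<Longrightarrow> \<eta> t > 0" and "u \<in> prob_simplex"
  shows "(\<Sum>t=1..T. ftrl_weights (\<eta> t) (L (t - 1)) \<bullet> z t)
    \<le> (\<Sum>t=1..T. stability (\<eta> t) (L (t - 1)) (z t)
         - (1 / \<eta> t - 1 / \<eta> (t - 1)) * tsallis_reg 1 (ftrl_weights (\<eta> t) (L (t - 1))))
      + u \<bullet> L T + 1 / \<eta> T * tsallis_reg 1 u"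
  using assms(5)
proof (induction T arbitrary: u)
  case 0
  then show ?case by (simp add: L(1) \<eta>(1))
next
  case (Suc T)
  define w where "w = ftrl_weights (\<eta> (Suc T)) (L T)"
  have pos: "\<eta> (Suc T) > 0" by (rule \<eta>(2)) simp
  have w: "w \<in> prob_simplex" unfolding w_def by (rule ftrl_weights_in_simplex[OF pos])
  have reg: "tsallis_reg (\<eta> (Suc T)) v = 1 / \<eta> (Suc T) * tsallis_reg 1 v" for v :: "real ^ 'k"
    by (simp add: tsallis_reg_def)
  have "w \<bullet> z (Suc T) \<le> stability (\<eta> (Suc T)) (L T) (z (Suc T))
      + ftrl_objective (\<eta> (Suc T)) (L (Suc T)) u - ftrl_objective (\<eta> (Suc T)) (L T) w"
    using ftrl_objective_min[OF pos Suc.prems, of "L (Suc T)"]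
    unfolding stability_def w_def L(2) by linarith
  then show ?case using Suc.IH[OF w]
    by (simp add: w_def[symmetric] ftrl_objective_def reg left_diff_distrib)
qed

lemma inverse_learning_rate: "1 / learning_rate e t = rate_factor e * sqrt (real t) / 2"
  by (simp add: learning_rate_eq)

definition round_bound :: "estimator \<Rightarrow> nat \<Rightarrow> real ^ 'k::finite \<Rightarrow> real" where
  "round_bound e t w = rate_factor e * ((if t = 1 then 0 else root_spread w / sqrt (real t))
     + 2 * (sqrt (real t) - sqrt (real (t - 1))) * root_excess w)"

definition penalty :: "estimator \<Rightarrow> nat \<Rightarrow> real ^ 'k::finite \<Rightarrow> real" where
  "penalty e t w = rate_factor e * (2 * (sqrt (real t) - sqrt (real (t - 1))) * root_excess w)"

lemma tsallis_regret_pathwise: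
  fixes l :: "nat \<Rightarrow> real ^ 'k::finite" and a :: "nat \<Rightarrow> 'k" and e :: estimator
  defines "L \<equiv> cum_estimate e l a" and "w \<equiv> tsallis_weights e l a"
  defines "z \<equiv> (\<lambda>t. loss_estimate e (learning_rate e t) (w t) (l t) (a t))"
  shows "(\<Sum>t=1..T. w t \<bullet> z t) - (\<Sum>t=1..T. z t $ i)
    \<le> (\<Sum>t=1..T. stability (learning_rate e t) (L (t - 1)) (z t) + penalty e t (w t))"
proof -
  define \<beta> where "\<beta> t = rate_factor e * sqrt (real t) / 2" for t
  define u :: "real ^ 'k" where "u = axis i 1"
  have u: "u \<in> prob_simplex" by (auto simp: u_def prob_simplex_def axis_def)
  have LS: "L (Suc t) = L t + z (Suc t)" for t
    by (simp add: L_def z_def w_def tsallis_weights_def)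
  have LT: "L T $ i = (\<Sum>t=1..T. z t $ i)"
    by (induction T) (simp_all add: LS, simp add: L_def)
  have "(\<Sum>j\<in>UNIV. sqrt (u $ j)) = (\<Sum>j\<in>UNIV. if j = i then 1 else 0)"
    by (intro sum.cong) (auto simp: u_def axis_def)
  then have reg_u: "tsallis_reg 1 u = - 2" by (simp add: tsallis_reg_simplex[OF u])
  have w: "w t \<in> prob_simplex" if "t \<ge> 1" for t
    unfolding w_def tsallis_weights_def using that by (intro ftrl_weights_in_simplex learning_rate_pos)
  have "(\<Sum>t=1..T. w t \<bullet> z t) \<le> (\<Sum>t=1..T. stability (learning_rate e t) (L (t - 1)) (z t)
         - (\<beta> t - \<beta> (t - 1)) * tsallis_reg 1 (w t)) + u \<bullet> L T + \<beta> T * tsallis_reg 1 u"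
    using ftrl_regret_pathwise[of L z "learning_rate e" u T] LS u learning_rate_pos[of _ e]
    unfolding inverse_learning_rate \<beta>_def[symmetric] w_def tsallis_weights_def
    by (simp add: L_def learning_rate_eq)
  also have "u \<bullet> L T = (\<Sum>t=1..T. z t $ i)" by (simp add: u_def inner_axis' LT)
  \<comment> \<open>The vertex \<open>u\<close> has regulariser \<open>- 2\<close>. Telescoping
    \<open>\<beta> T\<close> charges this to the rounds, where it cancels the constant in
    \<open>- tsallis_reg 1 (w t) = 2 + 4 * root_excess (w t)\<close>.\<close>
  also have "\<beta> T * tsallis_reg 1 u = (\<Sum>t=1..T. - 2 * (\<beta> t - \<beta> (t - 1)))"
  proof -
    have "\<beta> T = (\<Sum>t=1..T. \<beta> t - \<beta> (t - 1))" by (induction T) (simp_all, simp add: \<beta>_def)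
    then show ?thesis unfolding reg_u sum_distrib_left[symmetric] by simp
  qed
  finally have "(\<Sum>t=1..T. w t \<bullet> z t) - (\<Sum>t=1..T. z t $ i)
      \<le> (\<Sum>t=1..T. stability (learning_rate e t) (L (t - 1)) (z t)
         - (\<beta> t - \<beta> (t - 1)) * tsallis_reg 1 (w t) + - 2 * (\<beta> t - \<beta> (t - 1)))"
    by (simp add: sum.distrib)
  also have "\<dots> = (\<Sum>t=1..T. stability (learning_rate e t) (L (t - 1)) (z t) + penalty e t (w t))"
  proof (rule sum.cong)
    fix t assume "t \<in> {1..T}"
    then have reg: "tsallis_reg 1 (w t) = - 2 - 4 * root_excess (w t)"
      using w[of t] by (simp add: tsallis_reg_simplex root_excess_def)
    show "stability (learning_rate e t) (L (t - 1)) (z t)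
         - (\<beta> t - \<beta> (t - 1)) * tsallis_reg 1 (w t) + - 2 * (\<beta> t - \<beta> (t - 1))
        = stability (learning_rate e t) (L (t - 1)) (z t) + penalty e t (w t)"
      unfolding reg penalty_def \<beta>_def by (simp add: field_simps)
  qed simp
  finally show ?thesis .
qed

lemma round_bound_nonneg:
  assumes "w \<in> prob_simplex"
  shows "round_bound e t w \<ge> 0"
  unfolding round_bound_def
  using root_spread_nonneg[OF assms] root_excess_nonneg[OF assms] less_imp_le[OF rate_factor_pos[of e]]
  by (intro mult_nonneg_nonneg add_nonneg_nonneg) auto

text \<open>The \<open>- 1\<close> in \<open>root_excess w \<le> sqrt K - 1\<close> is kept: it
  yields \<open>- 2 * sqrt T\<close>, which later absorbs the logarithm in the (IW) slack.\<close>

lemma sum_round_bound_le: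
  fixes w :: "nat \<Rightarrow> real ^ 'k::finite"
  assumes "T \<ge> 1" "\<And>t. t \<ge> 1 \<Longrightarrow> w t \<in> prob_simplex"
  defines "K \<equiv> real CARD('k)"
  shows "(\<Sum>t=1..T. round_bound e t (w t)) \<le> rate_factor e * (4 * sqrt (K * real T) - 2 * sqrt (real T))"
proof -
  have "(\<Sum>t=1..T. round_bound e t (w t)) \<le> (\<Sum>t=1..T. rate_factor e *
      (sqrt K * (if t = 1 then 0 else 1 / sqrt (real t)) + 2 * (sqrt (real t) - sqrt (real (t - 1))) * (sqrt K - 1)))"
  proof (rule sum_mono)
    fix t assume "t \<in> {1..T}"
    then have w: "w t \<in> prob_simplex" using assms(2) by simp
    have A: "2 * (sqrt (real t) - sqrt (real (t - 1))) * root_excess (w t)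
        \<le> 2 * (sqrt (real t) - sqrt (real (t - 1))) * (sqrt K - 1)"
      using sum_sqrt_simplex_le[OF w] by (intro mult_left_mono) (auto simp: root_excess_def K_def)
    have B: "(if t = 1 then 0 else root_spread (w t) / sqrt (real t))
        \<le> sqrt K * (if t = 1 then 0 else 1 / sqrt (real t))"
      using root_spread_le[OF w] by (simp add: K_def divide_right_mono)
    show "round_bound e t (w t) \<le> rate_factor e *
      (sqrt K * (if t = 1 then 0 else 1 / sqrt (real t)) + 2 * (sqrt (real t) - sqrt (real (t - 1))) * (sqrt K - 1))"
      unfolding round_bound_def
      by (rule mult_left_mono[OF add_mono[OF B A] less_imp_le[OF rate_factor_pos]])
  qed
  also have "\<dots> = rate_factor e * (sqrt K * (\<Sum>t=1..T. if t = 1 then 0 else 1 / sqrt (real t))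
      + 2 * (\<Sum>t=1..T. sqrt (real t) - sqrt (real (t - 1))) * (sqrt K - 1))"
    by (simp only: sum_distrib_left[symmetric] sum_distrib_right[symmetric] sum.distrib)
  also have "(\<Sum>t=1..T. sqrt (real t) - sqrt (real (t - 1))) = sqrt (real T)"
    by (induction T) simp_all
  also have "rate_factor e * (sqrt K * (\<Sum>t=1..T. if t = 1 then 0 else 1 / sqrt (real t))
      + 2 * sqrt (real T) * (sqrt K - 1))
    \<le> rate_factor e * (sqrt K * (2 * sqrt (real T)) + 2 * sqrt (real T) * (sqrt K - 1))"
    using rate_factor_pos[of e] sum_inverse_sqrt_le[OF assms(1)]
    by (intro mult_left_mono add_right_mono) (auto simp: K_def)
  also have "\<dots> = rate_factor e * (4 * sqrt (K * real T) - 2 * sqrt (real T))"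
    by (simp add: real_sqrt_mult algebra_simps)
  finally show ?thesis .
qed

subsection \<open>Self-bounding\<close>

text \<open>\<open>x\<close> is the root of a weight and \<open>y\<close> the gap scaled by
  \<open>sqrt t / \<gamma>\<close>. The main part \<open>4 * x - x\<^sup>2 * y\<close> has maximum
  \<open>4 / y\<close>. For large \<open>y\<close> the term \<open>x\<^sup>2\<close> is absorbed by
  replacing \<open>y\<close> with \<open>y - 1\<close>; for small \<open>y\<close> it is controlled
  by \<open>x\<^sup>2 - 2 * x ^ 3 \<le> 1 / 27\<close>, with equality at \<open>x = 1 / 3\<close>.
  At the threshold \<open>11\<close> both errors fit under
  \<open>17 / 2 / 15\<^sup>2\<close>.\<close>

lemma arm_excess_le:
  fixes x y :: real
  assumes "0 \<le> x" "y > 0"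
  shows "4 * x + x\<^sup>2 - 2 * x ^ 3 - x\<^sup>2 * y \<le> 4 / y + 17 / 2 / (y + 4)\<^sup>2"
proof (cases "y \<ge> 11")
  case True
  have "0 \<le> (2 - x * (y - 1))\<^sup>2 / (y - 1)" using True by simp
  also have "\<dots> = 4 / (y - 1) - 4 * x + x\<^sup>2 * (y - 1)" using True by (simp add: field_simps power2_eq_square)
  finally have 1: "4 * x - x\<^sup>2 * (y - 1) \<le> 4 / (y - 1)" by linarith
  have "0 \<le> (y - 11) * (9 * y + 18) + 70" using True by simp
  then have "4 * (y + 4)\<^sup>2 \<le> 17 / 2 * (y * (y - 1))" by (simp add: power2_eq_square algebra_simps)
  then have "4 / (y * (y - 1)) \<le> 17 / 2 / (y + 4)\<^sup>2"
    using True by (subst divide_le_eq, simp, subst (asm) mult.commute) (simp add: field_simps)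
  moreover have "4 / (y - 1) - 4 / y = 4 / (y * (y - 1))" using True by (simp add: field_simps)
  moreover have "x ^ 3 \<ge> 0" using assms by simp
  moreover have "x\<^sup>2 * (y - 1) = x\<^sup>2 * y - x\<^sup>2" by (simp add: right_diff_distrib)
  ultimately show ?thesis using 1 by linarith
next
  case False
  have "0 \<le> (2 - x * y)\<^sup>2 / y" using assms by simp
  also have "\<dots> = 4 / y - 4 * x + x\<^sup>2 * y" using assms by (simp add: field_simps power2_eq_square)
  finally have 1: "4 * x - x\<^sup>2 * y \<le> 4 / y" by linarith
  have "0 \<le> 2 * ((x - 1 / 3)\<^sup>2 * (x + 1 / 6))" using assms by simp
  also have "\<dots> = 1 / 27 - x\<^sup>2 + 2 * x ^ 3" by (simp add: algebra_simps power2_eq_square power3_eq_cube)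
  finally have 2: "x\<^sup>2 - 2 * x ^ 3 \<le> 1 / 27" by linarith
  have "(y + 4)\<^sup>2 \<le> 15\<^sup>2" using False assms by (intro power_mono) auto
  then have "17 / 2 / 15\<^sup>2 \<le> 17 / 2 / (y + 4)\<^sup>2" using assms by (intro divide_left_mono) auto
  moreover have "1 / 27 \<le> 17 / 2 / (15 :: real)\<^sup>2" by (simp add: power2_eq_square)
  ultimately have "1 / 27 \<le> 17 / 2 / (y + 4)\<^sup>2" by (rule order_trans[rotated])
  then show ?thesis using 1 2 by linarith
qed

text \<open>The summand is the excess of one round in \<open>arm_excess_le\<close>; its shape is chosen so that
  \<open>17 / (D (\<surd>t D + 4))\<close> telescopes against it.\<close>

lemma sum_excess_telescope:
  assumes "D > 0"
  shows "(\<Sum>t=1..T. 17 / 2 / (sqrt (real t) * (sqrt (real t) * D + 4)\<^sup>2)) \<le> 17 / 4 / D"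
proof -
  have "(\<Sum>t=1..T. 17 / 2 / (sqrt (real t) * (sqrt (real t) * D + 4)\<^sup>2))
      \<le> 17 / D * (1 / 4 - 1 / (sqrt (real T) * D + 4))"
  proof (induction T)
    case (Suc n)
    define \<tau> where "\<tau> = sqrt (real (Suc n))"
    define \<sigma> where "\<sigma> = sqrt (real n)"
    have p: "\<tau> > 0" "\<sigma> \<ge> 0" "\<sigma> \<le> \<tau>" by (auto simp: \<tau>_def \<sigma>_def)
    have q: "\<tau> * D + 4 > 0" "\<sigma> * D + 4 > 0" using p assms by (auto simp: add_nonneg_pos)
    have "\<tau> - \<sigma> \<ge> 1 / (2 * \<tau>)" using sqrt_diff_ge[of "Suc n"] by (simp add: \<tau>_def \<sigma>_def)
    have "17 / 2 / (\<tau> * (\<tau> * D + 4)\<^sup>2) = 17 * (1 / (2 * \<tau>)) / ((\<tau> * D + 4) * (\<tau> * D + 4))"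
      by (simp add: power2_eq_square)
    also have "\<dots> \<le> 17 * (\<tau> - \<sigma>) / ((\<sigma> * D + 4) * (\<tau> * D + 4))"
      using p q assms \<open>\<tau> - \<sigma> \<ge> 1 / (2 * \<tau>)\<close>
      by (intro frac_le mult_left_mono mult_right_mono add_right_mono) auto
    also have "\<dots> = 17 / D * (1 / (\<sigma> * D + 4) - 1 / (\<tau> * D + 4))"
      using q assms by (simp add: divide_simps) algebra
    finally have "17 / 2 / (\<tau> * (\<tau> * D + 4)\<^sup>2) \<le> 17 / D * (1 / (\<sigma> * D + 4) - 1 / (\<tau> * D + 4))" .
    with Suc show ?case unfolding \<tau>_def \<sigma>_def by (simp add: right_diff_distrib)
  qed simp
  also have "\<dots> \<le> 17 / D * (1 / 4)"
    using assms by (intro mult_left_mono) (auto intro!: divide_nonneg_nonneg add_nonneg_nonneg)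
  finally show ?thesis by simp
qed

text \<open>Eliminates arm \<open>i\<close>, which will be the one without a gap. Its share
  \<open>sqrt w * (1 - w)\<close> is at most \<open>1 - w\<close>, the total weight of the others,
  and \<open>sqrt w - 1 \<le> - (1 - w) / 2\<close> because \<open>(sqrt w - 1)\<^sup>2\<close> is
  nonnegative.\<close>

lemma root_spread_excess_le:
  assumes "w \<in> prob_simplex"
  shows "root_spread w \<le> (\<Sum>j\<in>UNIV - {i}. sqrt (w $ j) * (1 - w $ j) + w $ j)"
    "root_excess w \<le> (\<Sum>j\<in>UNIV - {i}. sqrt (w $ j) - w $ j / 2)"
proof -
  have p: "(\<Sum>j\<in>UNIV - {i}. w $ j) = 1 - w $ i"
    using prob_simplexD(3)[OF assms] by (simp add: sum_diff1)
  have i: "0 \<le> w $ i" "w $ i \<le> 1" using prob_simplexD[OF assms] by auto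
  have "sqrt (w $ i) * (1 - w $ i) \<le> 1 - w $ i" using i by (simp add: mult_left_le_one_le)
  then show "root_spread w \<le> (\<Sum>j\<in>UNIV - {i}. sqrt (w $ j) * (1 - w $ j) + w $ j)"
    unfolding root_spread_def sum.distrib p by (subst sum.remove[of _ i]) auto
  have "0 \<le> (sqrt (w $ i) - 1)\<^sup>2" by simp
  also have "\<dots> = w $ i + 1 - 2 * sqrt (w $ i)" using i by (simp add: power2_diff)
  finally have "sqrt (w $ i) - 1 \<le> - ((1 - w $ i) / 2)" by (simp add: field_simps)
  then show "root_excess w \<le> (\<Sum>j\<in>UNIV - {i}. sqrt (w $ j) - w $ j / 2)"
    unfolding root_excess_def sum_subtractf sum_divide_distrib[symmetric] p
    by (subst sum.remove[of _ i]) auto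
qed

text \<open>For \<open>t > 1\<close> the penalty weight \<open>\<delta>\<close> splits into
  \<open>1 / \<tau>\<close>, which combines with the stability part to the polynomial of
  \<open>arm_excess_le\<close>, and a nonnegative rest that is summable, so there
  \<open>x - x\<^sup>2 / 2 \<le> 1\<close> is good enough.\<close>

lemma arm_round_le:
  fixes x \<gamma> D :: real
  assumes x: "0 \<le> x" "x \<le> 1" and "\<gamma> > 0" "D > 0" "t \<ge> 1"
  defines "\<tau> \<equiv> sqrt (real t)"
  defines "\<delta> \<equiv> 2 * (\<tau> - sqrt (real (t - 1)))"
  shows "2 * \<gamma> * ((if t = 1 then 0 else (x * (1 - x\<^sup>2) + x\<^sup>2) / \<tau>) + \<delta> * (x - x\<^sup>2 / 2)) - x\<^sup>2 * D
    \<le> 4 * \<gamma>\<^sup>2 / D * (1 / real t) + \<gamma> * (17 / 2 / (\<tau> * (\<tau> * (D / \<gamma>) + 4)\<^sup>2))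
      + 2 * \<gamma> * (if t = 1 then 0 else \<delta> - 1 / \<tau>)"
proof (cases "t = 1")
  case True
  then have "\<tau> = 1" "\<delta> = 2" by (auto simp: \<tau>_def \<delta>_def)
  have "0 \<le> (2 * \<gamma> - x * D)\<^sup>2 / D" using assms by simp
  also have "\<dots> = 4 * \<gamma>\<^sup>2 / D - 4 * \<gamma> * x + x\<^sup>2 * D" using assms by (simp add: field_simps power2_eq_square)
  finally have "4 * \<gamma> * x - x\<^sup>2 * D \<le> 4 * \<gamma>\<^sup>2 / D" by linarith
  moreover have "\<gamma> * (17 / 2 / (\<tau> * (\<tau> * (D / \<gamma>) + 4)\<^sup>2)) \<ge> 0" using assms by simp
  moreover have "\<gamma> * x\<^sup>2 \<ge> 0" using assms by simp
  ultimately show ?thesis using True \<open>\<delta> = 2\<close> by (simp add: algebra_simps)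
next
  case False
  have \<tau>: "\<tau> > 0" "\<tau>\<^sup>2 = real t" using assms by (auto simp: \<tau>_def)
  define y where "y = \<tau> * (D / \<gamma>)"
  have y: "y > 0" using \<tau> assms by (simp add: y_def)
  have \<rho>: "\<delta> - 1 / \<tau> \<ge> 0" using sqrt_diff_ge[OF \<open>t \<ge> 1\<close>] by (simp add: \<delta>_def \<tau>_def)
  have D: "D = \<gamma> * (y / \<tau>)" using \<tau> assms by (simp add: y_def)
  have "2 * \<gamma> * ((x * (1 - x\<^sup>2) + x\<^sup>2) / \<tau> + \<delta> * (x - x\<^sup>2 / 2)) - x\<^sup>2 * D
      = \<gamma> / \<tau> * (4 * x + x\<^sup>2 - 2 * x ^ 3 - x\<^sup>2 * y) + 2 * \<gamma> * ((\<delta> - 1 / \<tau>) * (x - x\<^sup>2 / 2))"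
    unfolding D using \<tau> by (simp add: field_simps power2_eq_square power3_eq_cube)
  also have "\<dots> \<le> \<gamma> / \<tau> * (4 / y + 17 / 2 / (y + 4)\<^sup>2) + 2 * \<gamma> * ((\<delta> - 1 / \<tau>) * 1)"
  proof (intro add_mono mult_left_mono arm_excess_le[OF x(1) y] \<rho>)
    have "x\<^sup>2 \<ge> 0" by simp
    then show "x - x\<^sup>2 / 2 \<le> 1" using x by linarith
  qed (use assms \<tau> in auto)
  also have "\<gamma> / \<tau> * (4 / y + 17 / 2 / (y + 4)\<^sup>2)
      = 4 * \<gamma>\<^sup>2 / D * (1 / real t) + \<gamma> * (17 / 2 / (\<tau> * (y + 4)\<^sup>2))"
  proof -
    have "\<gamma> / \<tau> * (4 / y) = 4 * \<gamma>\<^sup>2 / D * (1 / \<tau>\<^sup>2)"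
      unfolding y_def using \<tau>(1) assms by (simp add: field_simps power2_eq_square)
    then show ?thesis unfolding \<tau>(2) by (simp add: distrib_left)
  qed
  finally show ?thesis using False by (simp add: y_def)
qed

lemma sum_round_bound_self_bounding:
  fixes w :: "nat \<Rightarrow> real ^ 'k::finite" and \<Delta> :: "'k \<Rightarrow> real"
    and e :: estimator
  assumes "T \<ge> 1" and w: "\<And>t. t \<ge> 1 \<Longrightarrow> w t \<in> prob_simplex"
    and \<Delta>: "\<And>j. j \<noteq> i \<Longrightarrow> 0 < \<Delta> j" "\<And>j. j \<noteq> i \<Longrightarrow> \<Delta> j \<le> 1"
  defines "\<gamma> \<equiv> rate_factor e"
  shows "2 * (\<Sum>t=1..T. round_bound e t (w t)) - (\<Sum>t=1..T. \<Sum>j\<in>UNIV - {i}. w t $ j * \<Delta> j)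
    \<le> (\<Sum>j\<in>UNIV - {i}. (4 * \<gamma>\<^sup>2 * ln (real T) + (33 / 4 * \<gamma>\<^sup>2 + 83 / 50 * \<gamma>)) / \<Delta> j)"
proof -
  define \<tau> where "\<tau> t = sqrt (real t)" for t
  define \<delta> where "\<delta> t = 2 * (\<tau> t - sqrt (real (t - 1)))" for t
  define g where "g t x D = 2 * \<gamma> * ((if t = 1 then 0 else (x * (1 - x\<^sup>2) + x\<^sup>2) / \<tau> t) + \<delta> t * (x - x\<^sup>2 / 2)) - x\<^sup>2 * D"
    for t x D
  define h where "h t D = 4 * \<gamma>\<^sup>2 / D * (1 / real t) + \<gamma> * (17 / 2 / (\<tau> t * (\<tau> t * (D / \<gamma>) + 4)\<^sup>2))
      + 2 * \<gamma> * (if t = 1 then 0 else \<delta> t - 1 / \<tau> t)" for t D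
  have \<gamma>: "\<gamma> > 0" by (simp add: \<gamma>_def rate_factor_pos)
  have per_round: "2 * round_bound e t (w t) - (\<Sum>j\<in>UNIV - {i}. w t $ j * \<Delta> j)
      \<le> (\<Sum>j\<in>UNIV - {i}. h t (\<Delta> j))" if t: "t \<ge> 1" for t
  proof -
    note s = w[OF t]
    have sq: "w t $ j = (sqrt (w t $ j))\<^sup>2" for j using prob_simplexD[OF s] by simp
    have "round_bound e t (w t) \<le> \<gamma> * ((if t = 1 then 0 else (\<Sum>j\<in>UNIV - {i}. sqrt (w t $ j) * (1 - w t $ j) + w t $ j) / \<tau> t)
        + \<delta> t * (\<Sum>j\<in>UNIV - {i}. sqrt (w t $ j) - w t $ j / 2))"
      unfolding round_bound_def \<gamma>_def[symmetric] \<delta>_def \<tau>_def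
      using \<gamma> root_spread_excess_le[OF s, of i]
      by (intro mult_left_mono add_mono) (auto simp: divide_right_mono)
    also have "\<dots> = (\<Sum>j\<in>UNIV - {i}. \<gamma> * ((if t = 1 then 0 else (sqrt (w t $ j) * (1 - w t $ j) + w t $ j) / \<tau> t)
        + \<delta> t * (sqrt (w t $ j) - w t $ j / 2)))"
    proof -
      have "\<gamma> * ((if t = 1 then 0 else (\<Sum>j\<in>J. A j) / \<tau> t) + \<delta> t * (\<Sum>j\<in>J. B j))
          = (\<Sum>j\<in>J. \<gamma> * ((if t = 1 then 0 else A j / \<tau> t) + \<delta> t * B j))"
        for A B and J :: "'k set"
        by (cases "t = 1") (simp_all add: sum.distrib sum_distrib_left sum_divide_distrib distrib_left)
      then show ?thesis .
    qed
    finally have "2 * round_bound e t (w t) - (\<Sum>j\<in>UNIV - {i}. w t $ j * \<Delta> j)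
        \<le> (\<Sum>j\<in>UNIV - {i}. 2 * (\<gamma> * ((if t = 1 then 0 else (sqrt (w t $ j) * (1 - w t $ j) + w t $ j) / \<tau> t)
        + \<delta> t * (sqrt (w t $ j) - w t $ j / 2))) - w t $ j * \<Delta> j)"
      unfolding sum_subtractf sum_distrib_left[symmetric, of 2] by linarith
    also have "\<dots> = (\<Sum>j\<in>UNIV - {i}. g t (sqrt (w t $ j)) (\<Delta> j))"
      using prob_simplexD(1)[OF s] by (intro sum.cong) (auto simp: g_def)
    also have "\<dots> \<le> (\<Sum>j\<in>UNIV - {i}. h t (\<Delta> j))"
    proof (rule sum_mono)
      fix j assume "j \<in> UNIV - {i}"
      then have "\<Delta> j > 0" using \<Delta>(1) by simp
      then show "g t (sqrt (w t $ j)) (\<Delta> j) \<le> h t (\<Delta> j)"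
        unfolding g_def h_def \<tau>_def \<delta>_def
        using prob_simplexD[OF s] \<gamma> t by (intro arm_round_le) auto
    qed
    finally show ?thesis .
  qed
  have per_arm: "(\<Sum>t=1..T. h t D) \<le> (4 * \<gamma>\<^sup>2 * ln (real T) + (33 / 4 * \<gamma>\<^sup>2 + 83 / 50 * \<gamma>)) / D"
    if D: "D > 0" "D \<le> 1" for D
  proof -
    have "(\<Sum>t=1..T. h t D) = 4 * \<gamma>\<^sup>2 / D * (\<Sum>t=1..T. 1 / real t)
        + \<gamma> * (\<Sum>t=1..T. 17 / 2 / (\<tau> t * (\<tau> t * (D / \<gamma>) + 4)\<^sup>2))
        + 2 * \<gamma> * (\<Sum>t=1..T. if t = 1 then 0 else \<delta> t - 1 / \<tau> t)"
      unfolding h_def sum.distrib sum_distrib_left ..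
    also have "\<dots> \<le> 4 * \<gamma>\<^sup>2 / D * (1 + ln (real T)) + \<gamma> * (17 / 4 / (D / \<gamma>)) + 2 * \<gamma> * (83 / 100)"
      unfolding \<delta>_def \<tau>_def using D \<gamma>
      by (intro add_mono mult_left_mono sum_inverse_le_ln sum_excess_telescope sum_sqrt_defect_le assms(1)) auto
    \<comment> \<open>\<open>D \<le> 1\<close> allows the constant without a gap to be divided by
      \<open>D\<close>. The final \<open>33 / 4\<close> is \<open>4\<close> from the harmonic sum
      plus \<open>17 / 4\<close> from the telescoping one.\<close>
    also have "\<dots> \<le> 4 * \<gamma>\<^sup>2 / D * (1 + ln (real T)) + \<gamma> * (17 / 4 / (D / \<gamma>)) + 83 / 50 * \<gamma> / D"
      using D \<gamma> by (simp add: field_simps)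
    also have "\<dots> = (4 * \<gamma>\<^sup>2 * ln (real T) + (33 / 4 * \<gamma>\<^sup>2 + 83 / 50 * \<gamma>)) / D"
      using D \<gamma> by (simp add: field_simps power2_eq_square)
    finally show ?thesis .
  qed
  have "2 * (\<Sum>t=1..T. round_bound e t (w t)) - (\<Sum>t=1..T. \<Sum>j\<in>UNIV - {i}. w t $ j * \<Delta> j)
      = (\<Sum>t=1..T. 2 * round_bound e t (w t) - (\<Sum>j\<in>UNIV - {i}. w t $ j * \<Delta> j))"
    unfolding sum_subtractf sum_distrib_left ..
  also have "\<dots> \<le> (\<Sum>t=1..T. \<Sum>j\<in>UNIV - {i}. h t (\<Delta> j))"
    using per_round by (intro sum_mono) auto
  also have "\<dots> = (\<Sum>j\<in>UNIV - {i}. \<Sum>t=1..T. h t (\<Delta> j))" by (rule sum.swap)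
  also have "\<dots> \<le> (\<Sum>j\<in>UNIV - {i}. (4 * \<gamma>\<^sup>2 * ln (real T) + (33 / 4 * \<gamma>\<^sup>2 + 83 / 50 * \<gamma>)) / \<Delta> j)"
    using \<Delta> by (intro sum_mono per_arm) auto
  finally show ?thesis .
qed

text \<open>In \<open>(1 + \<mu>) * Reg - \<mu> * Reg\<close> the first term takes the upper bound
  and the second the lower one. The second claim balances \<open>A' / \<mu>\<close> against
  \<open>\<mu> * C\<close>, and \<open>A' < C\<close> keeps the balancing value at most
  \<open>1\<close>. Tuning for \<open>A'\<close> instead of \<open>A\<close> puts the larger
  constant directly under the root.\<close>

lemma self_bounding_tuning:
  fixes Reg U R A C X :: real
  assumes upper: "Reg \<le> U + R" and lower: "Reg \<ge> X - C" and "U \<ge> 0" "R \<ge> 0"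
    and tune: "\<And>\<mu>. 0 < \<mu> \<Longrightarrow> \<mu> \<le> 1 \<Longrightarrow> 2 * U - \<mu> * X \<le> A / \<mu>"
  shows "Reg \<le> A + C + 2 * R"
    and "0 \<le> A' \<Longrightarrow> A \<le> A' \<Longrightarrow> A' < C \<Longrightarrow> Reg \<le> 2 * sqrt (A' * C) + 2 * R"
proof -
  have *: "Reg \<le> A / \<mu> + \<mu> * C + 2 * R" if "0 < \<mu>" "\<mu> \<le> 1" for \<mu>
  proof -
    have "(1 + \<mu>) * Reg \<le> (1 + \<mu>) * (U + R)" using upper that by (intro mult_left_mono) auto
    also have "\<dots> \<le> 2 * (U + R)" using assms(3,4) that by (intro mult_right_mono) auto
    finally have "Reg + \<mu> * Reg \<le> 2 * U + 2 * R" by (simp add: algebra_simps)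
    moreover have "\<mu> * Reg \<ge> \<mu> * (X - C)" using lower that by (intro mult_left_mono) auto
    ultimately show ?thesis using tune[OF that] by (simp add: right_diff_distrib)
  qed
  from *[of 1] show "Reg \<le> A + C + 2 * R" by simp
  assume A': "0 \<le> A'" "A \<le> A'" "A' < C"
  show "Reg \<le> 2 * sqrt (A' * C) + 2 * R"
  proof (cases "A' = 0")
    \<comment> \<open>This happens with a single arm, where the gap sum is empty. Balancing would
      give \<open>\<mu> = 0\<close>, so that value is approached through
      \<open>\<epsilon>\<close>.\<close>
    case True
    show ?thesis
    proof (rule field_le_epsilon)
      fix \<epsilon> :: real assume "\<epsilon> > 0"
      define \<mu> where "\<mu> = min 1 (\<epsilon> / C)"
      have l: "0 < \<mu>" "\<mu> \<le> 1" "\<mu> \<le> \<epsilon> / C" using \<open>\<epsilon> > 0\<close> A' by (auto simp: \<mu>_def)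
      have "\<mu> * C \<le> \<epsilon>" using l(3) A' by (simp add: pos_le_divide_eq)
      moreover have "A / \<mu> \<le> 0" using A' True l by (simp add: divide_nonpos_pos)
      ultimately show "Reg \<le> 2 * sqrt (A' * C) + 2 * R + \<epsilon>" using *[OF l(1,2)] True by simp
    qed
  next
    case False
    then have pos: "A' > 0" "C > 0" using A' by auto
    define \<mu> where "\<mu> = sqrt (A' / C)"
    have l: "0 < \<mu>" "\<mu> \<le> 1" using pos A' by (auto simp: \<mu>_def)
    have C: "\<mu> * C = sqrt (A' * C)"
      using pos by (simp add: \<mu>_def real_sqrt_divide real_sqrt_mult field_simps)
    have "A' / \<mu> = sqrt (A' * C)"
      using pos by (simp add: \<mu>_def real_sqrt_divide real_sqrt_mult field_simps)
    moreover have "A / \<mu> \<le> A' / \<mu>" using A' l by (simp add: divide_right_mono)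
    ultimately show ?thesis using *[OF l] C by simp
  qed
qed

subsection \<open>Passing to expectations\<close>

lemma borel_measurable_vec_component:
  fixes f :: "'a \<Rightarrow> real ^ 'k::finite"
  assumes "f \<in> borel_measurable N"
  shows "(\<lambda>\<omega>. f \<omega> $ i) \<in> borel_measurable N"
proof -
  have "(\<lambda>\<omega>. f \<omega> \<bullet> axis i 1) \<in> borel_measurable N" using assms by measurable
  then show ?thesis by (simp add: inner_axis)
qed

lemma borel_measurable_vecI:
  fixes f :: "'a \<Rightarrow> real ^ 'k::finite"
  assumes "\<And>i. (\<lambda>\<omega>. f \<omega> $ i) \<in> borel_measurable N"
  shows "f \<in> borel_measurable N"
  using assms by (subst borel_measurable_euclidean_space) (auto simp: Basis_vec_def inner_axis)

lemma borel_measurable_ftrl_weights: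
  assumes "\<eta> > 0" "L \<in> borel_measurable N"
  shows "(\<lambda>\<omega>. ftrl_weights \<eta> (L \<omega>)) \<in> borel_measurable N"
  using borel_measurable_continuous_onI[OF continuous_ftrl_weights[OF assms(1)]] assms(2)
  by (rule measurable_compose[rotated])

lemma borel_measurable_ftrl_objective:
  assumes "L \<in> borel_measurable N" "w \<in> borel_measurable N"
  shows "(\<lambda>\<omega>. ftrl_objective \<eta> (L \<omega>) (w \<omega>)) \<in> borel_measurable N"
proof -
  note [measurable] = assms borel_measurable_vec_component[OF assms(2)]
  show ?thesis unfolding ftrl_objective_def tsallis_reg_def by measurable
qed

lemma borel_measurable_stability:
  assumes "\<eta> > 0" "L \<in> borel_measurable N" "z \<in> borel_measurable N"
  shows "(\<lambda>\<omega>. stability \<eta> (L \<omega>) (z \<omega>)) \<in> borel_measurable N"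
proof -
  have Lz: "(\<lambda>\<omega>. L \<omega> + z \<omega>) \<in> borel_measurable N" using assms by measurable
  note [measurable] = assms Lz borel_measurable_ftrl_weights[OF assms(1,2)]
    borel_measurable_ftrl_weights[OF assms(1) Lz]
    borel_measurable_ftrl_objective[OF assms(2) borel_measurable_ftrl_weights[OF assms(1,2)]]
    borel_measurable_ftrl_objective[OF Lz borel_measurable_ftrl_weights[OF assms(1) Lz]]
  show ?thesis unfolding stability_def by measurable
qed

lemma borel_measurable_loss_estimate:
  fixes w l :: "'a \<Rightarrow> real ^ 'k::finite"
  assumes "w \<in> borel_measurable N" "l \<in> borel_measurable N"
  shows "(\<lambda>\<omega>. loss_estimate e \<eta> (w \<omega>) (l \<omega>) a) \<in> borel_measurable N"
proof (rule borel_measurable_vecI)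
  fix i
  note [measurable] = borel_measurable_vec_component[OF assms(1)] borel_measurable_vec_component[OF assms(2)]
  show "(\<lambda>\<omega>. loss_estimate e \<eta> (w \<omega>) (l \<omega>) a $ i) \<in> borel_measurable N"
    by (cases e) (simp_all add: Let_def of_bool_def, measurable)
qed

lemma abs_simplex_inner_le:
  assumes "w \<in> prob_simplex" "\<And>i. \<bar>z $ i\<bar> \<le> c"
  shows "\<bar>w \<bullet> z\<bar> \<le> c"
proof -
  have "\<bar>w \<bullet> z\<bar> \<le> (\<Sum>i\<in>UNIV. \<bar>w $ i * z $ i\<bar>)"
    unfolding inner_vec_def by (simp add: sum_abs)
  also have "\<dots> \<le> (\<Sum>i\<in>UNIV. w $ i * c)"
    using assms prob_simplexD[OF assms(1)] by (intro sum_mono) (auto simp: abs_mult intro!: mult_left_mono)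
  finally show ?thesis using prob_simplexD(3)[OF assms(1)] by (simp add: sum_distrib_right[symmetric])
qed

lemma abs_ftrl_objective_le:
  fixes w L :: "real ^ 'k::finite"
  assumes "\<eta> > 0" "w \<in> prob_simplex" "\<And>i. \<bar>L $ i\<bar> \<le> c"
  shows "\<bar>ftrl_objective \<eta> L w\<bar> \<le> c + (4 * sqrt (real CARD('k)) + 2) / \<eta>"
proof -
  have "\<bar>2 - 4 * (\<Sum>i\<in>UNIV. sqrt (w $ i))\<bar> \<le> 4 * sqrt (real CARD('k)) + 2"
    using sum_sqrt_simplex_le[OF assms(2)] root_excess_nonneg[OF assms(2)] by (auto simp: root_excess_def abs_le_iff)
  then have "\<bar>tsallis_reg \<eta> w\<bar> \<le> (4 * sqrt (real CARD('k)) + 2) / \<eta>"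
    unfolding tsallis_reg_simplex[OF assms(2)] using assms(1) by (simp add: abs_divide divide_right_mono)
  then show ?thesis using abs_simplex_inner_le[OF assms(2), of L c] assms(3)
    unfolding ftrl_objective_def by (smt (verit))
qed

lemma abs_stability_le:
  fixes z L :: "real ^ 'k::finite"
  assumes "\<eta> > 0" "\<And>i. \<bar>L $ i\<bar> \<le> c" "\<And>i. \<bar>z $ i\<bar> \<le> d"
  shows "\<bar>stability \<eta> L z\<bar> \<le> 2 * (c + d + (4 * sqrt (real CARD('k)) + 2) / \<eta>)"
proof -
  note s = ftrl_weights_in_simplex[OF assms(1)]
  have "\<bar>(L + z) $ i\<bar> \<le> c + d" for i using assms(2)[of i] assms(3)[of i] by simp
  from abs_ftrl_objective_le[OF assms(1) s this] abs_ftrl_objective_le[OF assms(1) s assms(2)]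
    abs_simplex_inner_le[OF s assms(3)]
  show ?thesis unfolding stability_def by (smt (verit))
qed

lemma abs_loss_estimate_le:
  assumes "0 < w $ i" "l $ i \<in> {0..1}"
  shows "\<bar>loss_estimate e \<eta> w l a $ i\<bar> \<le> 1 / w $ i + 1"
proof -
  have d: "\<bar>x / w $ i\<bar> \<le> 1 / w $ i" if "\<bar>x\<bar> \<le> 1" for x
    using that assms(1) by (simp add: abs_divide divide_right_mono)
  have p: "0 < 1 / w $ i" using assms(1) by simp
  show ?thesis
  proof (cases e)
    case IW
    then show ?thesis using d[of "l $ i"] assms(2) p by (cases "a = i") auto
  next
    case RV
    define B :: real where "B = 1 / 2 * of_bool (w $ i \<ge> \<eta>\<^sup>2)"
    have B: "0 \<le> B" "B \<le> 1" by (auto simp: B_def)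
    have "\<bar>l $ i - B\<bar> \<le> 1" using assms(2) B by (auto simp: abs_le_iff)
    then have "\<bar>(l $ i - B) / w $ i\<bar> \<le> 1 / w $ i" by (rule d)
    then have "\<bar>of_bool (a = i) * ((l $ i - B) / w $ i) + B\<bar> \<le> 1 / w $ i + 1"
      using B p by (cases "a = i"; unfold abs_le_iff; simp; linarith)
    moreover have "loss_estimate e \<eta> w l a $ i = of_bool (a = i) * ((l $ i - B) / w $ i) + B"
      by (simp add: RV B_def Let_def)
    ultimately show ?thesis by (simp only:)
  qed
qed

section \<open>The random process: measurability, boundedness, sampling\<close>

context adversarial_tsallis_inf
begin

definition estimate_sum :: "nat \<Rightarrow> 'a \<Rightarrow> real ^ 'k" where
  "estimate_sum t \<omega> = cum_estimate e (\<lambda>s. loss s \<omega>) (\<lambda>s. arm s \<omega>) t"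

definition weights :: "nat \<Rightarrow> 'a \<Rightarrow> real ^ 'k" where
  "weights t \<omega> = tsallis_weights e (\<lambda>s. loss s \<omega>) (\<lambda>s. arm s \<omega>) t"

text \<open>The arm is a parameter: for fixed \<open>a\<close> the estimate is determined before the
  draw, hence \<open>H t\<close>-measurable, and the draw enters only by substituting
  \<open>arm t \<omega>\<close>.\<close>

definition estimate :: "nat \<Rightarrow> 'k \<Rightarrow> 'a \<Rightarrow> real ^ 'k" where
  "estimate t a \<omega> = loss_estimate e (learning_rate e t) (weights t \<omega>) (loss t \<omega>) a"

lemma weights_eq: "weights t \<omega> = ftrl_weights (learning_rate e t) (estimate_sum (t - 1) \<omega>)"
  by (simp add: weights_def tsallis_weights_def estimate_sum_def)

lemma estimate_sum_0: "estimate_sum 0 \<omega> = 0"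
  by (simp add: estimate_sum_def)

lemma estimate_sum_Suc: "estimate_sum (Suc t) \<omega> = estimate_sum t \<omega> + estimate (Suc t) (arm (Suc t) \<omega>) \<omega>"
  by (simp add: estimate_sum_def estimate_def weights_def tsallis_weights_def)

lemma weights_simplex: "t \<ge> 1 \<Longrightarrow> weights t \<omega> \<in> prob_simplex"
  unfolding weights_eq by (intro ftrl_weights_in_simplex learning_rate_pos)

lemma weights_pos: "t \<ge> 1 \<Longrightarrow> weights t \<omega> $ i > 0"
  unfolding weights_eq by (intro ftrl_weights_pos learning_rate_pos)

lemma H_mono: "s \<le> t \<Longrightarrow> f \<in> borel_measurable (H s) \<Longrightarrow> f \<in> borel_measurable (H t)"
  using sets_F_mono[of s t] space_F by (auto simp: measurable_def)

lemma H_measurable: "f \<in> borel_measurable (H t) \<Longrightarrow> f \<in> borel_measurable M"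
  by (rule measurable_from_subalg[OF subalg])

lemma estimate_measurable_aux:
  assumes "t \<ge> 1" "estimate_sum (t - 1) \<in> borel_measurable (H t)"
  shows "weights t \<in> borel_measurable (H t)" "estimate t a \<in> borel_measurable (H t)"
proof -
  show w: "weights t \<in> borel_measurable (H t)"
    using borel_measurable_ftrl_weights[OF learning_rate_pos[OF assms(1)] assms(2)]
    by (simp add: weights_eq[abs_def])
  show "estimate t a \<in> borel_measurable (H t)"
    unfolding estimate_def[abs_def] by (rule borel_measurable_loss_estimate[OF w loss_measurable[OF assms(1)]])
qed

lemma arm_compose_measurable:
  assumes "t \<ge> 1" "t < s" "\<And>a. g a \<in> borel_measurable (H s)"
  shows "(\<lambda>\<omega>. g (arm t \<omega>) \<omega>) \<in> borel_measurable (H s)"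
  by (rule measurable_compose_countable'[OF assms(3) arm_measurable[OF assms(1,2)]]) (auto intro: countable_finite)

text \<open>The index shifts by one because the arm of round \<open>t\<close> is guaranteed to be
  measurable only from \<open>H (Suc t)\<close> on.\<close>

lemma estimate_sum_measurable: "estimate_sum t \<in> borel_measurable (H (Suc t))"
proof (induction t)
  case 0
  then show ?case by (simp add: estimate_sum_0[abs_def])
next
  case (Suc t)
  have "estimate (Suc t) a \<in> borel_measurable (H (Suc (Suc t)))" for a
    by (rule H_mono[OF _ estimate_measurable_aux(2)[of "Suc t"]]) (use Suc in auto)
  then have [measurable]: "(\<lambda>\<omega>. estimate (Suc t) (arm (Suc t) \<omega>) \<omega>) \<in> borel_measurable (H (Suc (Suc t)))"
    by (intro arm_compose_measurable[where g = "estimate (Suc t)"]) simp_all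
  have [measurable]: "estimate_sum t \<in> borel_measurable (H (Suc (Suc t)))"
    by (rule H_mono[OF _ Suc]) simp
  show ?case unfolding estimate_sum_Suc[abs_def] by measurable
qed

lemma round_measurable:
  assumes "t \<ge> 1"
  shows "estimate_sum (t - 1) \<in> borel_measurable (H t)" "weights t \<in> borel_measurable (H t)"
    "estimate t a \<in> borel_measurable (H t)"
proof -
  show *: "estimate_sum (t - 1) \<in> borel_measurable (H t)"
    using estimate_sum_measurable[of "t - 1"] assms by simp
  show "weights t \<in> borel_measurable (H t)" "estimate t a \<in> borel_measurable (H t)"
    using estimate_measurable_aux[OF assms *] by auto
qed

lemma estimate_bounded_aux:
  assumes "t \<ge> 1" and c: "\<And>\<omega> i. \<omega> \<in> space M \<Longrightarrow> \<bar>estimate_sum (t - 1) \<omega> $ i\<bar> \<le> c" and "\<omega> \<in> space M"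
  shows "\<bar>estimate t a \<omega> $ i\<bar> \<le> (learning_rate e t * c + sqrt (real CARD('k)))\<^sup>2 + 1"
proof -
  define s where "s = 1 / sqrt (weights t \<omega> $ i)"
  have "s \<le> learning_rate e t * c + sqrt (real CARD('k))"
    unfolding s_def weights_eq using c[OF assms(3)] learning_rate_pos[OF assms(1)]
    by (rule ftrl_weights_inverse_sqrt_le[rotated])
  moreover have "s \<ge> 0" using weights_pos[OF assms(1), of \<omega> i] by (simp add: s_def)
  ultimately have "s\<^sup>2 \<le> (learning_rate e t * c + sqrt (real CARD('k)))\<^sup>2" by (intro power_mono)
  moreover have "s\<^sup>2 = 1 / weights t \<omega> $ i"
    using weights_pos[OF assms(1), of \<omega> i] by (simp add: s_def power_divide)
  ultimately have "1 / weights t \<omega> $ i + 1 \<le> (learning_rate e t * c + sqrt (real CARD('k)))\<^sup>2 + 1"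
    by simp
  with abs_loss_estimate_le[OF weights_pos[OF assms(1)] loss_range[OF assms(1,3)]]
  show ?thesis unfolding estimate_def by (rule order_trans)
qed

text \<open>A bound on the cumulative estimate keeps the next weights away from \<open>0\<close> and
  so bounds the next estimate. The constant grows fast with \<open>t\<close>, but it serves only
  integrability.\<close>

lemma estimate_sum_bounded: "\<exists>c. \<forall>\<omega>\<in>space M. \<forall>i. \<bar>estimate_sum t \<omega> $ i\<bar> \<le> c"
proof (induction t)
  case 0
  then show ?case by (auto simp: estimate_sum_0)
next
  case (Suc t)
  then obtain c where c: "\<And>\<omega> i. \<omega> \<in> space M \<Longrightarrow> \<bar>estimate_sum t \<omega> $ i\<bar> \<le> c" by blast
  have "\<bar>estimate_sum (Suc t) \<omega> $ i\<bar> \<le> c + ((learning_rate e (Suc t) * c + sqrt (real CARD('k)))\<^sup>2 + 1)"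
    if "\<omega> \<in> space M" for \<omega> i
    using estimate_bounded_aux[of "Suc t" c \<omega> "arm (Suc t) \<omega>" i] c that
    unfolding estimate_sum_Suc by (simp add: abs_triangle_ineq[THEN order_trans] add_mono)
  then show ?case by blast
qed

lemma round_bounded:
  assumes "t \<ge> 1"
  obtains c where "\<And>\<omega> i. \<omega> \<in> space M \<Longrightarrow> \<bar>estimate_sum (t - 1) \<omega> $ i\<bar> \<le> c"
    "\<And>\<omega> i a. \<omega> \<in> space M \<Longrightarrow> \<bar>estimate t a \<omega> $ i\<bar> \<le> c"
proof -
  obtain c where c: "\<And>\<omega> i. \<omega> \<in> space M \<Longrightarrow> \<bar>estimate_sum (t - 1) \<omega> $ i\<bar> \<le> c"
    using estimate_sum_bounded[of "t - 1"] by blast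
  define d where "d = (learning_rate e t * c + sqrt (real CARD('k)))\<^sup>2 + 1"
  have d: "\<And>\<omega> i a. \<omega> \<in> space M \<Longrightarrow> \<bar>estimate t a \<omega> $ i\<bar> \<le> d"
    unfolding d_def by (rule estimate_bounded_aux[OF assms c])
  show thesis by (rule that[of "max c d"]) (use c d in \<open>auto intro: le_max_iff_disj[THEN iffD2]\<close>)
qed

lemma bounded_integrable:
  assumes "f \<in> borel_measurable M" "\<And>\<omega>. \<omega> \<in> space M \<Longrightarrow> \<bar>f \<omega> :: real\<bar> \<le> B"
  shows "integrable M f"
  using assms by (intro integrable_const_bound[where B = B]) auto

lemma arm_event: "t \<ge> 1 \<Longrightarrow> {\<omega> \<in> space M. arm t \<omega> = i} \<in> sets M"
proof -
  assume t: "t \<ge> 1"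
  have "arm t \<in> measurable M (count_space UNIV)"
    using measurable_from_subalg[OF subalg arm_measurable[OF t, of "Suc t"]] by simp
  then have "arm t -` {i} \<inter> space M \<in> sets M" by (rule measurable_sets) simp
  moreover have "arm t -` {i} \<inter> space M = {\<omega> \<in> space M. arm t \<omega> = i}" by auto
  ultimately show ?thesis by simp
qed

text \<open>The tower rule for a draw with finitely many outcomes:
  \<open>g (arm t \<omega>) \<omega>\<close> is a sum of \<open>H t\<close>-measurable functions
  times indicators of the arms, and conditioning replaces each indicator by a weight.\<close>

lemma
  assumes t: "t \<ge> 1" and g: "\<And>a. g a \<in> borel_measurable (H t)"
    and B: "\<And>a \<omega>. \<omega> \<in> space M \<Longrightarrow> \<bar>g a \<omega> :: real\<bar> \<le> B"
  shows integrable_sampled: "integrable M (\<lambda>\<omega>. g (arm t \<omega>) \<omega>)"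
    and integrable_expected: "integrable M (\<lambda>\<omega>. \<Sum>a\<in>UNIV. weights t \<omega> $ a * g a \<omega>)"
    and integral_sampled: "(\<integral>\<omega>. g (arm t \<omega>) \<omega> \<partial>M) = (\<integral>\<omega>. (\<Sum>a\<in>UNIV. weights t \<omega> $ a * g a \<omega>) \<partial>M)"
proof -
  interpret F: finite_measure_subalgebra M "H t"
    by unfold_locales (rule subalg)
  let ?I = "\<lambda>a. indicator {\<omega> \<in> space M. arm t \<omega> = a} :: 'a \<Rightarrow> real"
  have gM: "g a \<in> borel_measurable M" for a by (rule H_measurable[OF g])
  have wM: "(\<lambda>\<omega>. weights t \<omega> $ a) \<in> borel_measurable M" for a
    by (rule borel_measurable_vec_component[OF H_measurable[OF round_measurable(2)[OF t]]])
  note [measurable] = gM wM arm_event[OF t]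
  have int: "integrable M (\<lambda>\<omega>. g a \<omega> * ?I a \<omega>)" for a
    using B by (intro bounded_integrable[where B = B]) (auto simp: indicator_def intro: order_trans[OF abs_ge_zero])
  have intw: "integrable M (\<lambda>\<omega>. weights t \<omega> $ a * g a \<omega>)" for a
  proof (rule bounded_integrable[where B = B])
    fix \<omega> assume "\<omega> \<in> space M"
    have "\<bar>weights t \<omega> $ a\<bar> * \<bar>g a \<omega>\<bar> \<le> 1 * \<bar>g a \<omega>\<bar>"
      using prob_simplexD(1,2)[OF weights_simplex[OF t]] by (intro mult_right_mono) auto
    then show "\<bar>weights t \<omega> $ a * g a \<omega>\<bar> \<le> B" using B[OF \<open>\<omega> \<in> space M\<close>, of a] by (simp add: abs_mult)
  qed measurable
  have eq: "(\<integral>\<omega>. g a \<omega> * ?I a \<omega> \<partial>M) = (\<integral>\<omega>. weights t \<omega> $ a * g a \<omega> \<partial>M)" for a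
  proof -
    have "(\<integral>\<omega>. g a \<omega> * ?I a \<omega> \<partial>M) = (\<integral>\<omega>. g a \<omega> * real_cond_exp M (H t) (?I a) \<omega> \<partial>M)"
      by (rule F.real_cond_exp_intg(2)[symmetric, OF int g]) measurable
    also have "\<dots> = (\<integral>\<omega>. weights t \<omega> $ a * g a \<omega> \<partial>M)"
      using arm_sampled[OF t, of a] unfolding weights_def[symmetric]
      by (intro integral_cong_AE) (auto elim!: eventually_mono)
    finally show ?thesis .
  qed
  have split: "g (arm t \<omega>) \<omega> = (\<Sum>a\<in>UNIV. g a \<omega> * ?I a \<omega>)" if "\<omega> \<in> space M" for \<omega>
  proof -
    have "(\<Sum>a\<in>UNIV. g a \<omega> * ?I a \<omega>) = (\<Sum>a\<in>UNIV. if a = arm t \<omega> then g a \<omega> else 0)"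
      using that by (intro sum.cong) (auto simp: indicator_def)
    then show ?thesis by simp
  qed
  have I: "integrable M (\<lambda>\<omega>. g (arm t \<omega>) \<omega>) \<longleftrightarrow> integrable M (\<lambda>\<omega>. \<Sum>a\<in>UNIV. g a \<omega> * ?I a \<omega>)"
    by (rule Bochner_Integration.integrable_cong[OF refl split])
  show "integrable M (\<lambda>\<omega>. g (arm t \<omega>) \<omega>)"
    by (rule iffD2[OF I]) (rule Bochner_Integration.integrable_sum[OF int])
  show "integrable M (\<lambda>\<omega>. \<Sum>a\<in>UNIV. weights t \<omega> $ a * g a \<omega>)"
    by (rule Bochner_Integration.integrable_sum[OF intw])
  have "(\<integral>\<omega>. g (arm t \<omega>) \<omega> \<partial>M) = (\<integral>\<omega>. (\<Sum>a\<in>UNIV. g a \<omega> * ?I a \<omega>) \<partial>M)"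
    by (rule Bochner_Integration.integral_cong[OF refl split])
  also have "\<dots> = (\<Sum>a\<in>UNIV. \<integral>\<omega>. g a \<omega> * ?I a \<omega> \<partial>M)" using int by (rule Bochner_Integration.integral_sum)
  also have "\<dots> = (\<integral>\<omega>. (\<Sum>a\<in>UNIV. weights t \<omega> $ a * g a \<omega>) \<partial>M)"
    unfolding eq using intw by (rule Bochner_Integration.integral_sum[symmetric])
  finally show "(\<integral>\<omega>. g (arm t \<omega>) \<omega> \<partial>M) = (\<integral>\<omega>. (\<Sum>a\<in>UNIV. weights t \<omega> $ a * g a \<omega>) \<partial>M)" .
qed

lemma loss_bounded: "t \<ge> 1 \<Longrightarrow> \<omega> \<in> space M \<Longrightarrow> \<bar>loss t \<omega> $ i\<bar> \<le> 1"
  using loss_range[of t \<omega> i] by auto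

lemma loss_component_measurable: "t \<ge> 1 \<Longrightarrow> (\<lambda>\<omega>. loss t \<omega> $ i) \<in> borel_measurable (H t)"
  by (rule borel_measurable_vec_component[OF loss_measurable])

lemma loss_integrable: "t \<ge> 1 \<Longrightarrow> integrable M (\<lambda>\<omega>. loss t \<omega> $ i)"
  using loss_bounded by (intro bounded_integrable[where B = 1] H_measurable[OF loss_component_measurable])

lemma suffered_loss:
  assumes t: "t \<ge> 1"
  shows "integrable M (\<lambda>\<omega>. loss t \<omega> $ arm t \<omega>)"
    "(\<integral>\<omega>. loss t \<omega> $ arm t \<omega> \<partial>M) = (\<integral>\<omega>. weights t \<omega> \<bullet> loss t \<omega> \<partial>M)"
proof -
  let ?g = "\<lambda>a \<omega>. loss t \<omega> $ a"
  show "integrable M (\<lambda>\<omega>. loss t \<omega> $ arm t \<omega>)"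
    by (rule integrable_sampled[where g = ?g, OF t loss_component_measurable[OF t] loss_bounded[OF t]])
  show "(\<integral>\<omega>. loss t \<omega> $ arm t \<omega> \<partial>M) = (\<integral>\<omega>. weights t \<omega> \<bullet> loss t \<omega> \<partial>M)"
    using integral_sampled[where g = ?g, OF t loss_component_measurable[OF t] loss_bounded[OF t]]
    by (simp add: inner_vec_def)
qed

lemma estimated_loss:
  assumes t: "t \<ge> 1"
  shows "integrable M (\<lambda>\<omega>. weights t \<omega> \<bullet> estimate t (arm t \<omega>) \<omega>)"
    "(\<integral>\<omega>. weights t \<omega> \<bullet> estimate t (arm t \<omega>) \<omega> \<partial>M) = (\<integral>\<omega>. weights t \<omega> \<bullet> loss t \<omega> \<partial>M)"
proof -
  obtain c where c: "\<And>\<omega> i a. \<omega> \<in> space M \<Longrightarrow> \<bar>estimate t a \<omega> $ i\<bar> \<le> c"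
    by (rule round_bounded[OF t]) blast
  let ?g = "\<lambda>a \<omega>. weights t \<omega> \<bullet> estimate t a \<omega>"
  have g: "(\<lambda>\<omega>. weights t \<omega> \<bullet> estimate t a \<omega>) \<in> borel_measurable (H t)" for a
    using round_measurable(2,3)[OF t] by measurable
  have B: "\<bar>weights t \<omega> \<bullet> estimate t a \<omega>\<bar> \<le> c" if "\<omega> \<in> space M" for a \<omega>
    by (rule abs_simplex_inner_le[OF weights_simplex[OF t] c[OF that]])
  show "integrable M (\<lambda>\<omega>. weights t \<omega> \<bullet> estimate t (arm t \<omega>) \<omega>)"
    by (rule integrable_sampled[where g = ?g, OF t g B])
  have "(\<Sum>a\<in>UNIV. weights t \<omega> $ a * (weights t \<omega> \<bullet> estimate t a \<omega>)) = weights t \<omega> \<bullet> loss t \<omega>" for \<omega>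
    unfolding estimate_def by (rule expected_inner_estimate[OF weights_simplex[OF t] weights_pos[OF t]])
  then show "(\<integral>\<omega>. weights t \<omega> \<bullet> estimate t (arm t \<omega>) \<omega> \<partial>M) = (\<integral>\<omega>. weights t \<omega> \<bullet> loss t \<omega> \<partial>M)"
    using integral_sampled[where g = ?g, OF t g B] by simp
qed

lemma estimated_arm_loss:
  assumes t: "t \<ge> 1"
  shows "integrable M (\<lambda>\<omega>. estimate t (arm t \<omega>) \<omega> $ i)"
    "(\<integral>\<omega>. estimate t (arm t \<omega>) \<omega> $ i \<partial>M) = (\<integral>\<omega>. loss t \<omega> $ i \<partial>M)"
proof -
  obtain c where c: "\<And>\<omega> i a. \<omega> \<in> space M \<Longrightarrow> \<bar>estimate t a \<omega> $ i\<bar> \<le> c"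
    by (rule round_bounded[OF t]) blast
  let ?g = "\<lambda>a \<omega>. estimate t a \<omega> $ i"
  have g: "(\<lambda>\<omega>. estimate t a \<omega> $ i) \<in> borel_measurable (H t)" for a
    by (rule borel_measurable_vec_component[OF round_measurable(3)[OF t]])
  show "integrable M (\<lambda>\<omega>. estimate t (arm t \<omega>) \<omega> $ i)"
    by (rule integrable_sampled[where g = ?g, OF t g c])
  have "(\<Sum>a\<in>UNIV. weights t \<omega> $ a * estimate t a \<omega> $ i) = loss t \<omega> $ i" for \<omega>
    unfolding estimate_def by (rule loss_estimate_unbiased[OF weights_simplex[OF t] weights_pos[OF t]])
  then show "(\<integral>\<omega>. estimate t (arm t \<omega>) \<omega> $ i \<partial>M) = (\<integral>\<omega>. loss t \<omega> $ i \<partial>M)"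
    using integral_sampled[where g = ?g, OF t g c] by simp
qed

lemma expected_stability_integral:
  fixes t
  defines "\<eta> \<equiv> learning_rate e t"
  assumes t: "t \<ge> 1"
  shows "integrable M (\<lambda>\<omega>. stability \<eta> (estimate_sum (t - 1) \<omega>) (estimate t (arm t \<omega>) \<omega>))"
    "integrable M (\<lambda>\<omega>. expected_stability e \<eta> (estimate_sum (t - 1) \<omega>) (loss t \<omega>))"
    "(\<integral>\<omega>. stability \<eta> (estimate_sum (t - 1) \<omega>) (estimate t (arm t \<omega>) \<omega>) \<partial>M)
      = (\<integral>\<omega>. expected_stability e \<eta> (estimate_sum (t - 1) \<omega>) (loss t \<omega>) \<partial>M)"
proof -
  have \<eta>: "\<eta> > 0" unfolding \<eta>_def by (rule learning_rate_pos[OF t])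
  obtain c where c: "\<And>\<omega> i. \<omega> \<in> space M \<Longrightarrow> \<bar>estimate_sum (t - 1) \<omega> $ i\<bar> \<le> c"
    "\<And>\<omega> i a. \<omega> \<in> space M \<Longrightarrow> \<bar>estimate t a \<omega> $ i\<bar> \<le> c"
    by (rule round_bounded[OF t]) blast
  let ?g = "\<lambda>a \<omega>. stability \<eta> (estimate_sum (t - 1) \<omega>) (estimate t a \<omega>)"
  have g: "?g a \<in> borel_measurable (H t)" for a
    by (rule borel_measurable_stability[OF \<eta> round_measurable(1,3)[OF t]])
  have B: "\<bar>?g a \<omega>\<bar> \<le> 2 * (c + c + (4 * sqrt (real CARD('k)) + 2) / \<eta>)" if "\<omega> \<in> space M" for a \<omega>
    by (rule abs_stability_le[OF \<eta> c(1)[OF that] c(2)[OF that]])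
  have eq: "(\<Sum>a\<in>UNIV. weights t \<omega> $ a * ?g a \<omega>)
      = expected_stability e \<eta> (estimate_sum (t - 1) \<omega>) (loss t \<omega>)" for \<omega>
    by (simp add: expected_stability_def weights_eq estimate_def \<eta>_def)
  show "integrable M (\<lambda>\<omega>. ?g (arm t \<omega>) \<omega>)" by (rule integrable_sampled[where g = ?g, OF t g B])
  show "integrable M (\<lambda>\<omega>. expected_stability e \<eta> (estimate_sum (t - 1) \<omega>) (loss t \<omega>))"
    using integrable_expected[where g = ?g, OF t g B] unfolding eq .
  show "(\<integral>\<omega>. ?g (arm t \<omega>) \<omega> \<partial>M) = (\<integral>\<omega>. expected_stability e \<eta> (estimate_sum (t - 1) \<omega>) (loss t \<omega>) \<partial>M)"
    using integral_sampled[where g = ?g, OF t g B] unfolding eq .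
qed

lemma weights_component_measurable: "t \<ge> 1 \<Longrightarrow> (\<lambda>\<omega>. weights t \<omega> $ i) \<in> borel_measurable M"
  by (rule borel_measurable_vec_component[OF H_measurable[OF round_measurable(2)]])

lemma weights_component_integrable: "t \<ge> 1 \<Longrightarrow> integrable M (\<lambda>\<omega>. weights t \<omega> $ i)"
  using prob_simplexD(1,2)[OF weights_simplex]
  by (intro bounded_integrable[where B = 1] weights_component_measurable) auto

lemma root_functionals_integrable:
  assumes t: "t \<ge> 1"
  shows "integrable M (\<lambda>\<omega>. root_spread (weights t \<omega>))" "integrable M (\<lambda>\<omega>. root_excess (weights t \<omega>))"
proof -
  note [measurable] = weights_component_measurable[OF t]
  have s: "weights t \<omega> \<in> prob_simplex" for \<omega> by (rule weights_simplex[OF t])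
  show "integrable M (\<lambda>\<omega>. root_spread (weights t \<omega>))"
    using root_spread_nonneg[OF s] root_spread_le[OF s]
    by (intro bounded_integrable[where B = "sqrt (real CARD('k))"]) (auto simp: root_spread_def)
  show "integrable M (\<lambda>\<omega>. root_excess (weights t \<omega>))"
  proof (rule bounded_integrable)
    fix \<omega>
    show "\<bar>root_excess (weights t \<omega>)\<bar> \<le> sqrt (real CARD('k))"
      using root_excess_nonneg[OF s, of \<omega>] sum_sqrt_simplex_le[OF s, of \<omega>] by (simp add: root_excess_def)
  qed (simp add: root_excess_def)
qed

lemma round_integrable:
  assumes t: "t \<ge> 1"
  shows "integrable M (\<lambda>\<omega>. round_bound e t (weights t \<omega>))" "integrable M (\<lambda>\<omega>. penalty e t (weights t \<omega>))"
  using root_functionals_integrable[OF t] by (cases "t = 1"; simp add: round_bound_def penalty_def)+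

lemma regret_le_round_bounds:
  assumes "T \<ge> 1"
  shows "pseudo_regret M loss arm T
    \<le> (\<integral>\<omega>. (\<Sum>t=1..T. round_bound e t (weights t \<omega>)) \<partial>M) + total_slack e (real CARD('k)) T"
proof -
  define S where "S t \<omega> = stability (learning_rate e t) (estimate_sum (t - 1) \<omega>) (estimate t (arm t \<omega>) \<omega>)" for t \<omega>
  define V where "V t \<omega> = expected_stability e (learning_rate e t) (estimate_sum (t - 1) \<omega>) (loss t \<omega>)" for t \<omega>
  define W where "W t \<omega> = weights t \<omega> \<bullet> estimate t (arm t \<omega>) \<omega>" for t \<omega>
  note int = estimated_loss(1) estimated_arm_loss(1) expected_stability_integral(1,2) round_integrable
  have intW: "integrable M (W t)" and intS: "integrable M (S t)" and intV: "integrable M (V t)" if "t \<in> {1..T}" for t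
    using that int[of t] by (simp_all add: W_def[abs_def] S_def[abs_def] V_def[abs_def])
  have SV: "(\<integral>\<omega>. S t \<omega> \<partial>M) = (\<integral>\<omega>. V t \<omega> \<partial>M)" if "t \<in> {1..T}" for t
    using that unfolding S_def V_def by (intro expected_stability_integral(3)) simp
  \<comment> \<open>The minimum of the expectations is attained at a fixed, nonrandom arm, so
    unbiasedness in each coordinate suffices to replace its losses by estimates.\<close>
  have "(MIN i. \<integral>\<omega>. (\<Sum>t=1..T. loss t \<omega> $ i) \<partial>M) \<in> range (\<lambda>i. \<integral>\<omega>. (\<Sum>t=1..T. loss t \<omega> $ i) \<partial>M)"
    by (intro Min_in) auto
  then obtain i where i: "(MIN i. \<integral>\<omega>. (\<Sum>t=1..T. loss t \<omega> $ i) \<partial>M) = (\<integral>\<omega>. (\<Sum>t=1..T. loss t \<omega> $ i) \<partial>M)"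
    by blast
  have "pseudo_regret M loss arm T = (\<Sum>t=1..T. \<integral>\<omega>. loss t \<omega> $ arm t \<omega> \<partial>M) - (\<Sum>t=1..T. \<integral>\<omega>. loss t \<omega> $ i \<partial>M)"
    unfolding pseudo_regret_def i
    by (subst (1 2) Bochner_Integration.integral_sum) (auto simp: suffered_loss(1) loss_integrable)
  also have "\<dots> = (\<Sum>t=1..T. \<integral>\<omega>. W t \<omega> \<partial>M) - (\<Sum>t=1..T. \<integral>\<omega>. estimate t (arm t \<omega>) \<omega> $ i \<partial>M)"
    by (simp add: suffered_loss(2) W_def estimated_loss(2) estimated_arm_loss(2))
  also have "\<dots> = (\<integral>\<omega>. (\<Sum>t=1..T. W t \<omega>) \<partial>M) - (\<integral>\<omega>. (\<Sum>t=1..T. estimate t (arm t \<omega>) \<omega> $ i) \<partial>M)"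
    using intW int(2) by (subst (1 2) Bochner_Integration.integral_sum) auto
  also have "\<dots> = (\<integral>\<omega>. (\<Sum>t=1..T. W t \<omega>) - (\<Sum>t=1..T. estimate t (arm t \<omega>) \<omega> $ i) \<partial>M)"
    using intW int(2)
    by (intro Bochner_Integration.integral_diff[symmetric] Bochner_Integration.integrable_sum) auto
  also have "\<dots> \<le> (\<integral>\<omega>. (\<Sum>t=1..T. S t \<omega> + penalty e t (weights t \<omega>)) \<partial>M)"
  proof (rule integral_mono)
    fix \<omega>
    show "(\<Sum>t=1..T. W t \<omega>) - (\<Sum>t=1..T. estimate t (arm t \<omega>) \<omega> $ i)
        \<le> (\<Sum>t=1..T. S t \<omega> + penalty e t (weights t \<omega>))"
      using tsallis_regret_pathwise[where l = "\<lambda>s. loss s \<omega>" and a = "\<lambda>s. arm s \<omega>" and e = e and T = T and i = i]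
      by (simp add: W_def S_def estimate_def weights_def estimate_sum_def)
  qed (use intW intS int in \<open>auto intro!: Bochner_Integration.integrable_diff Bochner_Integration.integrable_sum Bochner_Integration.integrable_add\<close>)
  also have "\<dots> = (\<Sum>t=1..T. (\<integral>\<omega>. S t \<omega> \<partial>M) + (\<integral>\<omega>. penalty e t (weights t \<omega>) \<partial>M))"
    using intS int(6) by (simp add: Bochner_Integration.integral_sum)
  also have "\<dots> = (\<Sum>t=1..T. (\<integral>\<omega>. V t \<omega> + penalty e t (weights t \<omega>) \<partial>M))"
    using SV intV int(6) by (intro sum.cong) (auto simp: Bochner_Integration.integral_add)
  also have "\<dots> \<le> (\<Sum>t=1..T. (\<integral>\<omega>. round_bound e t (weights t \<omega>) + stability_slack e (real CARD('k)) t \<partial>M))"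
  proof (intro sum_mono integral_mono)
    fix t \<omega> assume t: "t \<in> {1..T}" "\<omega> \<in> space M"
    have "V t \<omega> \<le> rate_factor e * (if t = 1 then 0 else root_spread (weights t \<omega>) / sqrt (real t))
        + stability_slack e (real CARD('k)) t"
      unfolding V_def weights_eq by (rule expected_stability_bound) (use t loss_range in auto)
    then show "V t \<omega> + penalty e t (weights t \<omega>)
        \<le> round_bound e t (weights t \<omega>) + stability_slack e (real CARD('k)) t"
      unfolding round_bound_def penalty_def distrib_left by linarith
  qed (use intV int in \<open>auto intro!: Bochner_Integration.integrable_add\<close>)
  also have "\<dots> = (\<integral>\<omega>. (\<Sum>t=1..T. round_bound e t (weights t \<omega>)) \<partial>M) + (\<Sum>t=1..T. stability_slack e (real CARD('k)) t)"
    using int(5) by (simp add: Bochner_Integration.integral_sum sum.distrib prob_space)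
  also have "\<dots> \<le> (\<integral>\<omega>. (\<Sum>t=1..T. round_bound e t (weights t \<omega>)) \<partial>M) + total_slack e (real CARD('k)) T"
    using sum_stability_slack_le[OF assms, of "real CARD('k)" e] by simp
  finally show ?thesis .
qed

end

section \<open>Assembling the regret bounds\<close>

lemma min_gap_nonneg: "min_gap \<Delta> \<ge> 0"
proof (cases "\<exists>i. \<Delta> $ i > 0")
  case True
  have "Min {\<Delta> $ i | i. \<Delta> $ i > 0} \<in> {\<Delta> $ i | i. \<Delta> $ i > 0}" using True by (intro Min_in) auto
  then show ?thesis using True by (auto simp: min_gap_def)
qed (simp add: min_gap_def)

definition log_numerator :: "estimator \<Rightarrow> nat \<Rightarrow> real" where
  "log_numerator e T = (case e of IW \<Rightarrow> 4 * ln (real T) + 12 | RV \<Rightarrow> ln (real T) + 3)"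

text \<open>The constants add up to \<open>9.91 \<le> 12\<close> for (IW) and, much tighter, to
  \<open>33 / 16 + 83 / 100 = 2.8925 \<le> 3\<close> for (RV). The latter is why the lower-order
  terms were estimated so carefully.\<close>

lemma log_numerator_ge:
  "4 * (rate_factor e)\<^sup>2 * ln (real T) + (33 / 4 * (rate_factor e)\<^sup>2 + 83 / 50 * rate_factor e) \<le> log_numerator e T"
  by (cases e) (simp_all add: rate_factor_def log_numerator_def power2_eq_square)

lemma (in adversarial_tsallis_inf) regret_adversarial:
  assumes "T \<ge> 1"
  defines "K \<equiv> real CARD('k)"
  shows "pseudo_regret M loss arm T \<le> (case e of
             IW \<Rightarrow> 4 * sqrt (K * real T) + 1
           | RV \<Rightarrow> 2 * sqrt (K * real T) + 10 * K * ln (real T) + 16)"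
proof -
  have "(\<integral>\<omega>. (\<Sum>t=1..T. round_bound e t (weights t \<omega>)) \<partial>M)
      \<le> rate_factor e * (4 * sqrt (K * real T) - 2 * sqrt (real T))"
    unfolding K_def by (intro integral_le_const Bochner_Integration.integrable_sum round_integrable AE_I2
        sum_round_bound_le assms(1) weights_simplex) auto
  then have *: "pseudo_regret M loss arm T
      \<le> rate_factor e * (4 * sqrt (K * real T) - 2 * sqrt (real T)) + total_slack e K T"
    using regret_le_round_bounds[OF assms(1)] unfolding K_def by linarith
  have "ln (sqrt (real T)) \<le> sqrt (real T) - 1" using assms(1) by (intro ln_le_minus_one) auto
  then have "ln (real T) \<le> 2 * sqrt (real T)" using assms(1) by (simp add: ln_sqrt)
  moreover have "0 \<le> sqrt (real T)" by simp
  ultimately show ?thesis using *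
    by (cases e; simp only: rate_factor_def total_slack_def estimator.case; argo)
qed

lemma (in adversarial_tsallis_inf) regret_self_bounding:
  fixes \<Delta> :: "real ^ 'k" and i :: 'k and C :: real and T :: nat
  defines "K \<equiv> real CARD('k)" and "Reg \<equiv> pseudo_regret M loss arm T"
    and "S \<equiv> (\<Sum>j\<in>UNIV - {i}. log_numerator e T / \<Delta> $ j)"
  assumes "T \<ge> 1" and \<Delta>: "\<And>j. \<Delta> $ j \<in> {0..1}" "\<And>j. j \<noteq> i \<Longrightarrow> \<Delta> $ j > 0"
    and lower: "Reg \<ge> (\<integral>\<omega>. (\<Sum>t=1..T. \<Sum>j\<in>UNIV - {i}. weights t \<omega> $ j * \<Delta> $ j) \<partial>M) - C"
  shows "Reg \<le> S + C + 2 * total_slack e K T"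
    and "C > S + 2 / min_gap \<Delta> \<Longrightarrow> Reg \<le> 2 * sqrt ((S + 2 / min_gap \<Delta>) * C) + 2 * total_slack e K T"
proof -
  define U where "U = (\<integral>\<omega>. (\<Sum>t=1..T. round_bound e t (weights t \<omega>)) \<partial>M)"
  define X where "X = (\<integral>\<omega>. (\<Sum>t=1..T. \<Sum>j\<in>UNIV - {i}. weights t \<omega> $ j * \<Delta> $ j) \<partial>M)"
  have intU: "integrable M (\<lambda>\<omega>. \<Sum>t=1..T. round_bound e t (weights t \<omega>))"
    by (intro Bochner_Integration.integrable_sum round_integrable) auto
  have intX: "integrable M (\<lambda>\<omega>. \<Sum>t=1..T. \<Sum>j\<in>UNIV - {i}. weights t \<omega> $ j * \<Delta> $ j)"
    by (intro Bochner_Integration.integrable_sum integrable_mult_left weights_component_integrable) auto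
  have upper: "Reg \<le> U + total_slack e K T"
    unfolding Reg_def U_def K_def by (rule regret_le_round_bounds[OF \<open>T \<ge> 1\<close>])
  have "U \<ge> 0" unfolding U_def
    by (intro integral_nonneg_AE AE_I2 sum_nonneg round_bound_nonneg weights_simplex) auto
  have slack: "total_slack e K T \<ge> 0"
    using \<open>T \<ge> 1\<close> by (cases e) (simp_all add: total_slack_def K_def)
  have N: "log_numerator e T \<ge> 0" using \<open>T \<ge> 1\<close> by (cases e) (simp_all add: log_numerator_def)
  then have S: "S \<ge> 0" unfolding S_def using \<Delta> by (intro sum_nonneg divide_nonneg_nonneg) auto
  have tune: "2 * U - \<mu> * X \<le> S / \<mu>" if l: "0 < \<mu>" "\<mu> \<le> 1" for \<mu>
  proof -
    have "2 * U - \<mu> * X = (\<integral>\<omega>. 2 * (\<Sum>t=1..T. round_bound e t (weights t \<omega>))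
        - \<mu> * (\<Sum>t=1..T. \<Sum>j\<in>UNIV - {i}. weights t \<omega> $ j * \<Delta> $ j) \<partial>M)"
      unfolding U_def X_def using intU intX by simp
    also have "\<dots> \<le> S / \<mu>"
    proof (intro integral_le_const AE_I2)
      fix \<omega>
      \<comment> \<open>The pathwise bound is applied to the gaps
        \<open>\<mu> * \<Delta> $ j\<close>, which still lie in \<open>(0, 1]\<close> for
        \<open>j \<noteq> i\<close>; dividing by them produces \<open>S / \<mu>\<close>.\<close>
      have "2 * (\<Sum>t=1..T. round_bound e t (weights t \<omega>))
          - (\<Sum>t=1..T. \<Sum>j\<in>UNIV - {i}. weights t \<omega> $ j * (\<mu> * \<Delta> $ j))
        \<le> (\<Sum>j\<in>UNIV - {i}. (4 * (rate_factor e)\<^sup>2 * ln (real T)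
            + (33 / 4 * (rate_factor e)\<^sup>2 + 83 / 50 * rate_factor e)) / (\<mu> * \<Delta> $ j))"
        using \<Delta> l by (intro sum_round_bound_self_bounding \<open>T \<ge> 1\<close> weights_simplex mult_pos_pos mult_le_one) auto
      also have "\<dots> \<le> (\<Sum>j\<in>UNIV - {i}. log_numerator e T / (\<mu> * \<Delta> $ j))"
        using \<Delta> l by (intro sum_mono divide_right_mono log_numerator_ge) auto
      also have "\<dots> = S / \<mu>" by (simp add: S_def sum_divide_distrib mult.commute)
      finally show "2 * (\<Sum>t=1..T. round_bound e t (weights t \<omega>))
        - \<mu> * (\<Sum>t=1..T. \<Sum>j\<in>UNIV - {i}. weights t \<omega> $ j * \<Delta> $ j) \<le> S / \<mu>"
        by (simp add: sum_distrib_left mult_ac)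
    qed (use intU intX in auto)
    finally show ?thesis .
  qed
  note bounds = self_bounding_tuning[OF upper lower[folded X_def] \<open>U \<ge> 0\<close> slack tune]
  show "Reg \<le> S + C + 2 * total_slack e K T" by (rule bounds(1))
  assume "C > S + 2 / min_gap \<Delta>"
  moreover have "2 / min_gap \<Delta> \<ge> 0" using min_gap_nonneg[of \<Delta>] by simp
  ultimately show "Reg \<le> 2 * sqrt ((S + 2 / min_gap \<Delta>) * C) + 2 * total_slack e K T"
    using S by (intro bounds(2)) auto
qed

theorem theorem1:
  fixes M :: "'a measure" and H :: "nat \<Rightarrow> 'a measure"
    and loss :: "nat \<Rightarrow> 'a \<Rightarrow> real ^ 'k::finite" and arm :: "nat \<Rightarrow> 'a \<Rightarrow> 'k"
    and e :: estimator and T :: nat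
  defines "K \<equiv> real CARD('k)"
    and "Reg \<equiv> pseudo_regret M loss arm T"
  assumes "adversarial_tsallis_inf M H loss arm e"
    and "T \<ge> 1"
  shows "Reg \<le> (case e of
             IW \<Rightarrow> 4 * sqrt (K * real T) + 1
           | RV \<Rightarrow> 2 * sqrt (K * real T) + 10 * K * ln (real T) + 16)
    \<and> (\<forall>(\<Delta> :: real ^ 'k) istar (C :: real).
         (\<forall>i. \<Delta> $ i \<in> {0..1}) \<and> \<Delta> $ istar = 0 \<and> (\<forall>i. i \<noteq> istar \<longrightarrow> \<Delta> $ i > 0) \<and>
         Reg \<ge> (\<integral>\<omega>. (\<Sum>t=1..T. \<Sum>i\<in>UNIV - {istar}.
                    tsallis_weights e (\<lambda>s. loss s \<omega>) (\<lambda>s. arm s \<omega>) t $ i * \<Delta> $ i) \<partial>M) - C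
         \<longrightarrow>
         Reg \<le> (case e of
             IW \<Rightarrow> (\<Sum>i\<in>UNIV - {istar}. (4 * ln (real T) + 12) / \<Delta> $ i)
                    + 4 * ln (real T) + 2 / min_gap \<Delta> + 3 / 2 * sqrt K + 8 + C
           | RV \<Rightarrow> (\<Sum>i\<in>UNIV - {istar}. (ln (real T) + 3) / \<Delta> $ i)
                    + 28 * K * ln (real T) + 2 / min_gap \<Delta> + 3 / 2 * sqrt K + 32 + C)
         \<and> (case e of
             IW \<Rightarrow>
               C > (\<Sum>i\<in>UNIV - {istar}. (4 * ln (real T) + 12) / \<Delta> $ i) + 2 / min_gap \<Delta> \<longrightarrow>
               Reg \<le> 2 * sqrt (((\<Sum>i\<in>UNIV - {istar}. (4 * ln (real T) + 12) / \<Delta> $ i)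
                                  + 2 / min_gap \<Delta>) * C)
                       + 4 * ln (real T) + 3 / 2 * sqrt K + 8
           | RV \<Rightarrow>
               C > (\<Sum>i\<in>UNIV - {istar}. (ln (real T) + 3) / \<Delta> $ i) + 2 / min_gap \<Delta> \<longrightarrow>
               Reg \<le> 2 * sqrt (((\<Sum>i\<in>UNIV - {istar}. (ln (real T) + 3) / \<Delta> $ i)
                                  + 2 / min_gap \<Delta>) * C)
                       + 28 * K * ln (real T) + 3 / 2 * sqrt K + 32))"
proof (intro conjI allI impI)
  interpret adversarial_tsallis_inf M H loss arm e by fact
  have "ln (real T) \<ge> 0" "K \<ge> 1" using assms(4) by (auto simp: K_def Suc_leI)
  \<comment> \<open>Twice the slack is \<open>2 + 2 * ln T\<close> for (IW) and
    \<open>30 + 20 * K * ln T\<close> for (RV).\<close>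
  then have slack: "2 * total_slack e K T + 0 \<le> (case e of
      IW \<Rightarrow> 4 * ln (real T) + 8 | RV \<Rightarrow> 28 * K * ln (real T) + 32)"
    by (cases e) (simp_all add: total_slack_def mult_right_mono)
  have K: "0 \<le> 3 / 2 * sqrt K" by (simp add: K_def)
  show "Reg \<le> (case e of
             IW \<Rightarrow> 4 * sqrt (K * real T) + 1
           | RV \<Rightarrow> 2 * sqrt (K * real T) + 10 * K * ln (real T) + 16)"
    unfolding Reg_def K_def by (rule regret_adversarial[OF assms(4)])
  fix \<Delta> :: "real ^ 'k" and istar :: 'k and C :: real
  assume *: "(\<forall>i. \<Delta> $ i \<in> {0..1}) \<and> \<Delta> $ istar = 0 \<and> (\<forall>i. i \<noteq> istar \<longrightarrow> \<Delta> $ i > 0) \<and>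
         Reg \<ge> (\<integral>\<omega>. (\<Sum>t=1..T. \<Sum>i\<in>UNIV - {istar}.
                    tsallis_weights e (\<lambda>s. loss s \<omega>) (\<lambda>s. arm s \<omega>) t $ i * \<Delta> $ i) \<partial>M) - C"
  define S where "S = (\<Sum>j\<in>UNIV - {istar}. log_numerator e T / \<Delta> $ j)"
  have gap: "2 / min_gap \<Delta> \<ge> 0" using min_gap_nonneg[of \<Delta>] by simp
  have 1: "Reg \<le> S + C + 2 * total_slack e K T"
    unfolding Reg_def S_def K_def
    by (rule regret_self_bounding(1)) (use * assms(4) in \<open>auto simp: Reg_def weights_def\<close>)
  have 2: "Reg \<le> 2 * sqrt ((S + 2 / min_gap \<Delta>) * C) + 2 * total_slack e K T" if "C > S + 2 / min_gap \<Delta>"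
    using that unfolding Reg_def S_def K_def
    by (intro regret_self_bounding(2)) (use * assms(4) in \<open>auto simp: Reg_def weights_def\<close>)
  show "Reg \<le> (case e of
             IW \<Rightarrow> (\<Sum>i\<in>UNIV - {istar}. (4 * ln (real T) + 12) / \<Delta> $ i)
                    + 4 * ln (real T) + 2 / min_gap \<Delta> + 3 / 2 * sqrt K + 8 + C
           | RV \<Rightarrow> (\<Sum>i\<in>UNIV - {istar}. (ln (real T) + 3) / \<Delta> $ i)
                    + 28 * K * ln (real T) + 2 / min_gap \<Delta> + 3 / 2 * sqrt K + 32 + C)"
    using 1 slack gap K unfolding S_def log_numerator_def
    by (cases e; simp only: estimator.case; linarith)
  show "case e of
             IW \<Rightarrow>
               C > (\<Sum>i\<in>UNIV - {istar}. (4 * ln (real T) + 12) / \<Delta> $ i) + 2 / min_gap \<Delta> \<longrightarrow>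
               Reg \<le> 2 * sqrt (((\<Sum>i\<in>UNIV - {istar}. (4 * ln (real T) + 12) / \<Delta> $ i)
                                  + 2 / min_gap \<Delta>) * C)
                       + 4 * ln (real T) + 3 / 2 * sqrt K + 8
           | RV \<Rightarrow>
               C > (\<Sum>i\<in>UNIV - {istar}. (ln (real T) + 3) / \<Delta> $ i) + 2 / min_gap \<Delta> \<longrightarrow>
               Reg \<le> 2 * sqrt (((\<Sum>i\<in>UNIV - {istar}. (ln (real T) + 3) / \<Delta> $ i)
                                  + 2 / min_gap \<Delta>) * C)
                       + 28 * K * ln (real T) + 3 / 2 * sqrt K + 32"
    using 2 slack K unfolding S_def log_numerator_def
    by (cases e; simp only: estimator.case; intro impI; linarith)
qed

end
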